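(* Let $f_1,\dots,f_s$ be nonzero elements of $\mathbf F=\mathbb K[\![x_1,\dots,x_n]\!]$, let $\mathbf A=\mathbb K[\![f_1,\dots,f_s]\!]$, and let $a\in U_1^n$. Suppose that $\mathrm{exp}(\mathbf A,a)$ is finitely generated. Let $\phi:\mathbb K[X_1,\dots,X_s]\to\mathbb K[\mathrm M(f_1,a),\dots,\mathrm M(f_s,a)]$ be the ring morphism with $\phi(X_i)=\mathrm M(f_i,a)$ for $1\le i\le s$, let $\{\bar S_1,\dots,\bar S_m\}$ be a set of generators of $\mathrm{Ker}(\phi)$, and let $S_i=\bar S_i(f_1,\dots,f_s)$ for all $i\in\{1,\dots,m\}$. For each $i$ let $R_a(S_i,\{f_1,\dots,f_s\})$ be an $a$-remainder of the division of $S_i$ by $\{f_1,\dots,f_s\}$. (1) If $R_a(S_i,\{f_1,\dots,f_s\})=0$ for all $i\in\{1,\dots,m\}$, then $\{f_1,\dots,f_s\}$ is an $a$-canonical basis of $\mathbf A$. (2) If $R_a(S_i,\{f_1,\dots,f_s\})\ne0$ for some $i\in\{1,\dots,m\}$, add all the nonzero remainders to $\{f_1,\dots,f_s\}$ and restart with the new system of generators of $\mathbf A$, say $\{f_1,\dots,f_s,f_{s+1},\dots,f_{s+s_1}\}$ (taking now a set of generators of the kernel of the morphism $\phi$ attached to this new system). In this case $\langle\mathrm{exp}(f_1,a),\dots,\mathrm{exp}(f_s,a)\rangle\subsetneq\langle\mathrm{exp}(f_1,a),\dots,\mathrm{exp}(f_{s+s_1},a)\rangle\subseteq\mathrm{exp}(\mathbf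 A,a)$. This process stops after finitely many steps, so that it constructs, starting from the generators $f_1,\dots,f_s$ of $\mathbf A$, an $a$-canonical basis of $\mathbf A$.
   Context: $\mathbb K$ is a field, $n\ge 1$, $\underline x=(x_1,\dots,x_n)$, $\mathbf F=\mathbb K[\![x_1,\dots,x_n]\!]$, $U=\mathbb R_{>0}$, $U_1=\mathbb Q_{>0}$. Fix a total well ordering $\prec$ on $\mathbb N^n$ compatible with sums. For $a\in U^n$ and a nonzero $f=\sum c_\alpha\underline x^\alpha\in\mathbf F$: $\mathrm{Supp}(f)=\{\alpha\mid c_\alpha\ne0\}$; $\nu(f,a)=\min\{a\cdot\alpha\mid\alpha\in\mathrm{Supp}(f)\}$, where $a\cdot\alpha=\sum_i a_i\alpha_i$; $\mathrm{in}(f,a)=\sum_{\alpha\in\mathrm{Supp}(f),\,a\cdot\alpha=\nu(f,a)}c_\alpha\underline x^\alpha$; $\mathrm{exp}(f,a)=\max_\prec\mathrm{Supp}(\mathrm{in}(f,a))$; $\mathrm M(f,a)=c_{\mathrm{exp}(f,a)}\underline x^{\mathrm{exp}(f,a)}$. The total ordering $<_a$ on $\mathbb N^n$ is: $\alpha<_a\alpha'$ iff $a\cdot\alpha>a\cdot\alpha'$, or $a\cdot\alpha=a\cdot\alpha'$ and $\alpha\prec\alpha'$; thus $\mathrm{exp}(f,a)=\max_{<_a}\mathrm{Supp}(f)$. For $S\subseteq\mathbf F$, $\mathbb K[\![S]\!]$ is the closure, in the $(x_1,\dots,x_n)$-adic topology, of the $\mathbb K$-subalgebra generated by $S$ (for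 a finite set of series without constant term it is the set of all formal power series in them). For elements of $\mathbb N^n$, $\langle\cdots\rangle$ denotes the subsemigroup (containing $0$) they generate. $\mathrm{exp}(\mathbf A,a)=\{\mathrm{exp}(f,a)\mid f\in\mathbf A\setminus\{0\}\}$, a subsemigroup of $\mathbb N^n$. A finite set $\{g_1,\dots,g_r\}\subseteq\mathbf A$ is an $a$-canonical basis of $\mathbf A$ if $\mathrm{exp}(\mathbf A,a)=\langle\mathrm{exp}(g_1,a),\dots,\mathrm{exp}(g_r,a)\rangle$. $a$-remainder: for nonzero $F_1,\dots,F_q\in\mathbf F$ and $0\ne F\in\mathbf F$, an $a$-remainder $R=R_a(F,\{F_1,\dots,F_q\})$ is an element $R\in\mathbf F$ for which there is $H\in\mathbb K[\![F_1,\dots,F_q]\!]$ such that: (i) $F=H+R$, and $\mathrm{exp}(F,a)=\max_{<_a}(\mathrm{exp}(H,a),\mathrm{exp}(R,a))$ if $H\neq0\neq R$; (ii) $H$ has an expression $H=\sum_\alpha c_\alpha\prod_{i}F_i^{\alpha_i}$ (convergent sum) with $\mathrm{exp}(F,a)\ge_a\mathrm{exp}(\prod_iF_i^{\alpha_i},a)$ whenever $c_\alpha\ne0$, and if $R=0$ there is a unique $\alpha^0$ with $c_{\alpha^0}\neq0$ and $\mathrm{exp}(F,a)=\mathrm{exp}(\prod_iF_i^{\alpha^0_i},a)$; (iii) if $R\ne0$, then every $\beta\in\mathrm{Supp}(R)$ satisfies $\beta\notin\langle\mathrm{exp}(F_1,a),\dots,\mathrm{exp}(F_q,a)\rangle$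 and $\beta\le_a\mathrm{exp}(F,a)$. Such remainders exist but need not be unique; by convention $R_a(0,\cdot)=0$.
   Formalization: In (1) and in each step of the process the generators of Ker(φ) are assumed homogeneous for deg X_i = exp(f_i,a) (e.g. binomials); for arbitrary generators (1) fails, e.g. x², x²+x⁴, x⁶+x⁷ with P+Q, P+2Q, where P=X_2−X_1, Q=X_3−X_1³. *)

theory Defs
  imports "HOL-Analysis.Analysis" "HOL-Library.Poly_Mapping"
begin

section \<open>Formal power series in finitely many variables\<close>

text \<open>The variables are indexed by the finite type \<open>'n\<close>, exponents are vectors in \<open>nat ^ 'n\<close>, and
  a series is given by its family of coefficients.\<close>

typedef ('a, 'n) mps = "UNIV :: (nat ^ 'n \<Rightarrow> 'a) set"
  morphisms mcoeff Mps ..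

lemma mcoeff_Mps [simp]: "mcoeff (Mps c) = c"
  by (simp add: Mps_inverse)

lemma mps_eqI: "(\<And>\<alpha>. mcoeff f \<alpha> = mcoeff g \<alpha>) \<Longrightarrow> f = g"
  by (metis mcoeff_inject ext)

abbreviation splits :: "nat ^ 'n \<Rightarrow> ((nat ^ 'n) \<times> (nat ^ 'n)) set" where
  "splits \<gamma> \<equiv> {(\<alpha>, \<beta>). \<alpha> + \<beta> = \<gamma>}"

lemma finite_below_vec: "finite {\<alpha> :: nat ^ 'n :: finite. \<forall>i. \<alpha> $ i \<le> \<gamma> $ i}"
proof -
  have "{\<alpha> :: nat ^ 'n. \<forall>i. \<alpha> $ i \<le> \<gamma> $ i} \<subseteq> vec_lambda ` (PiE UNIV (\<lambda>i. {..\<gamma> $ i}))"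
  proof
    fix \<alpha> :: "nat ^ 'n"
    assume "\<alpha> \<in> {\<alpha>. \<forall>i. \<alpha> $ i \<le> \<gamma> $ i}"
    then have "vec_nth \<alpha> \<in> PiE UNIV (\<lambda>i. {..\<gamma> $ i})"
      by (simp add: PiE_iff)
    then show "\<alpha> \<in> vec_lambda ` (PiE UNIV (\<lambda>i. {..\<gamma> $ i}))"
      by (metis image_eqI vec_nth_inverse)
  qed
  then show ?thesis
    by (rule finite_subset) (intro finite_imageI finite_PiE; simp)
qed

lemma finite_splits [simp]: "finite (splits (\<gamma> :: nat ^ 'n :: finite))"
proof -
  have "splits \<gamma> \<subseteq> {\<alpha>. \<forall>i. \<alpha> $ i \<le> \<gamma> $ i} \<times> {\<alpha>. \<forall>i. \<alpha> $ i \<le> \<gamma> $ i}"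
    by auto
  then show ?thesis
    by (rule finite_subset) (intro finite_cartesian_product finite_below_vec)
qed

instantiation mps :: (comm_ring_1, finite) comm_ring_1
begin

definition zero_mps_def: "0 = Mps (\<lambda>_. 0)"
definition one_mps_def: "1 = Mps (\<lambda>\<alpha>. if \<alpha> = 0 then 1 else 0)"
definition plus_mps_def: "f + g = Mps (\<lambda>\<alpha>. mcoeff f \<alpha> + mcoeff g \<alpha>)"
definition minus_mps_def: "f - g = Mps (\<lambda>\<alpha>. mcoeff f \<alpha> - mcoeff g \<alpha>)"
definition uminus_mps_def: "- f = Mps (\<lambda>\<alpha>. - mcoeff f \<alpha>)"
definition times_mps_def:
  "f * g = Mps (\<lambda>\<gamma>. \<Sum>(\<alpha>, \<beta>) \<in> splits \<gamma>. mcoeff f \<alpha> * mcoeff g \<beta>)"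

instance
proof
  fix f g h :: "('a, 'b) mps"
  show "f + g + h = f + (g + h)" "f + g = g + f" "0 + f = f" "- f + f = 0" "f - g = f + - g"
    by (simp_all add: zero_mps_def plus_mps_def minus_mps_def uminus_mps_def algebra_simps
        mcoeff_inverse)
  show "(f + g) * h = f * h + g * h"
    by (simp add: plus_mps_def times_mps_def algebra_simps sum.distrib split_def)
  show "f * g = g * f"
  proof (rule mps_eqI)
    fix \<gamma>
    show "mcoeff (f * g) \<gamma> = mcoeff (g * f) \<gamma>"
      unfolding times_mps_def mcoeff_Mps
      by (rule sum.reindex_bij_witness[where i = prod.swap and j = prod.swap])
        (auto simp: ac_simps)
  qed
  show "1 * f = f"
  proof (rule mps_eqI)
    fix \<gamma>
    have "mcoeff (1 * f) \<gamma> = (\<Sum>x \<in> splits \<gamma>. if x = (0, \<gamma>) then mcoeff f \<gamma> else 0)"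
      unfolding times_mps_def one_mps_def mcoeff_Mps
    proof (rule sum.cong)
      fix x assume "x \<in> splits \<gamma>"
      then show "(case x of (\<alpha>, \<beta>) \<Rightarrow> (if \<alpha> = 0 then 1 else 0) * mcoeff f \<beta>) =
          (if x = (0, \<gamma>) then mcoeff f \<gamma> else 0)"
        by (cases x; cases "fst x = 0") simp_all
    qed simp
    also have "\<dots> = mcoeff f \<gamma>"
      by (subst sum.delta) auto
    finally show "mcoeff (1 * f) \<gamma> = mcoeff f \<gamma>" .
  qed
  show "f * g * h = f * (g * h)"
  proof (rule mps_eqI)
    fix \<gamma>
    have "mcoeff (f * g * h) \<gamma> =
        (\<Sum>x \<in> splits \<gamma>. \<Sum>y \<in> splits (fst x). mcoeff f (fst y) * mcoeff g (snd y) * mcoeff h (snd x))"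
      by (simp add: times_mps_def split_def sum_distrib_right)
    also have "\<dots> = (\<Sum>(x, y) \<in> (SIGMA x : splits \<gamma>. splits (fst x)).
        mcoeff f (fst y) * mcoeff g (snd y) * mcoeff h (snd x))"
      by (rule sum.Sigma) auto
    also have "\<dots> = (\<Sum>(x, y) \<in> (SIGMA x : splits \<gamma>. splits (snd x)).
        mcoeff f (fst x) * (mcoeff g (fst y) * mcoeff h (snd y)))"
      by (rule sum.reindex_bij_witness[where
            i = "\<lambda>(x, y). ((fst x + fst y, snd y), (fst x, fst y))" and
            j = "\<lambda>(x, y). ((fst y, snd y + snd x), (snd y, snd x))"])
        (auto simp: ac_simps)
    also have "\<dots> = (\<Sum>x \<in> splits \<gamma>. \<Sum>y \<in> splits (snd x).
        mcoeff f (fst x) * (mcoeff g (fst y) * mcoeff h (snd y)))"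
      by (rule sum.Sigma[symmetric]) auto
    also have "\<dots> = mcoeff (f * (g * h)) \<gamma>"
      by (simp add: times_mps_def split_def sum_distrib_left)
    finally show "mcoeff (f * g * h) \<gamma> = mcoeff (f * (g * h)) \<gamma>" .
  qed
  show "(0 :: ('a, 'b) mps) \<noteq> 1"
  proof
    assume "(0 :: ('a, 'b) mps) = 1"
    then have "mcoeff (0 :: ('a, 'b) mps) 0 = mcoeff 1 0"
      by (rule arg_cong)
    then show False
      by (simp add: zero_mps_def one_mps_def)
  qed
qed

end

definition mps_const :: "'a \<Rightarrow> ('a :: zero, 'n :: finite) mps" where
  "mps_const c = Mps (\<lambda>\<alpha>. if \<alpha> = 0 then c else 0)"

definition supp :: "('a :: zero, 'n :: finite) mps \<Rightarrow> (nat ^ 'n) set" where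
  "supp f = {\<alpha>. mcoeff f \<alpha> \<noteq> 0}"

text \<open>The topology defined by the ideal \<open>(x\<^sub>1, \<dots>, x\<^sub>n)\<close>: the \<open>N\<close>-th power of this ideal consists of
  the series all of whose terms have total degree at least \<open>N\<close>.\<close>

instantiation mps :: (type, finite) topological_space
begin

definition open_mps_def:
  "open U \<longleftrightarrow> (\<forall>f \<in> U. \<exists>N :: nat. \<forall>g.
     (\<forall>\<alpha>. (\<Sum>i \<in> UNIV. \<alpha> $ i) < N \<longrightarrow> mcoeff g \<alpha> = mcoeff f \<alpha>) \<longrightarrow> g \<in> U)"

instance
proof
  show "open (UNIV :: ('a, 'b) mps set)"
    by (simp add: open_mps_def)
next
  fix U V :: "('a, 'b) mps set"
  assume UV: "open U" "open V"
  show "open (U \<inter> V)"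
    unfolding open_mps_def
  proof
    fix f assume "f \<in> U \<inter> V"
    then obtain N M where
      "\<And>g. (\<forall>\<alpha>. (\<Sum>i \<in> UNIV. \<alpha> $ i) < N \<longrightarrow> mcoeff g \<alpha> = mcoeff f \<alpha>) \<Longrightarrow> g \<in> U"
      "\<And>g. (\<forall>\<alpha>. (\<Sum>i \<in> UNIV. \<alpha> $ i) < M \<longrightarrow> mcoeff g \<alpha> = mcoeff f \<alpha>) \<Longrightarrow> g \<in> V"
      using UV unfolding open_mps_def by (metis IntE)
    then show "\<exists>N. \<forall>g. (\<forall>\<alpha>. (\<Sum>i \<in> UNIV. \<alpha> $ i) < N \<longrightarrow> mcoeff g \<alpha> = mcoeff f \<alpha>) \<longrightarrow> g \<in> U \<inter> V"
      by (intro exI[of _ "max N M"]) auto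
  qed
next
  fix K :: "('a, 'b) mps set set"
  assume "\<forall>U \<in> K. open U"
  then show "open (\<Union> K)"
    unfolding open_mps_def by (meson UnionE UnionI)
qed

end

text \<open>\<open>subalg S\<close> is the subalgebra over the ground field generated by \<open>S\<close>, and \<open>power_subalg S\<close>
  is \<open>\<bbbK>[[S]]\<close>.\<close>

inductive_set subalg :: "('a :: comm_ring_1, 'n :: finite) mps set \<Rightarrow> ('a, 'n) mps set"
  for S where
  const: "mps_const c \<in> subalg S"
| gen: "f \<in> S \<Longrightarrow> f \<in> subalg S"
| add: "f \<in> subalg S \<Longrightarrow> g \<in> subalg S \<Longrightarrow> f + g \<in> subalg S"
| mult: "f \<in> subalg S \<Longrightarrow> g \<in> subalg S \<Longrightarrow> f * g \<in> subalg S"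

definition power_subalg :: "('a :: comm_ring_1, 'n :: finite) mps set \<Rightarrow> ('a, 'n) mps set" where
  "power_subalg S = closure (subalg S)"


section \<open>Leading exponents\<close>

text \<open>\<open>monomial_order prec\<close>: the strict relation \<open>prec\<close> is a total well ordering compatible with
  sums.\<close>

definition monomial_order :: "(nat ^ 'n \<Rightarrow> nat ^ 'n \<Rightarrow> bool) \<Rightarrow> bool" where
  "monomial_order prec \<longleftrightarrow> irreflp prec \<and> transp prec \<and> totalp prec \<and> wfp prec \<and>
     (\<forall>\<alpha> \<beta> \<gamma>. prec \<alpha> \<beta> \<longrightarrow> prec (\<alpha> + \<gamma>) (\<beta> + \<gamma>))"

definition weight :: "real ^ 'n \<Rightarrow> nat ^ 'n \<Rightarrow> real" where
  "weight a \<alpha> = (\<Sum>i \<in> UNIV. a $ i * real (\<alpha> $ i))"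

text \<open>\<open>\<alpha> <\<^sub>a \<beta>\<close>; note that larger weight means smaller exponent.\<close>

definition less_a ::
  "(nat ^ 'n \<Rightarrow> nat ^ 'n \<Rightarrow> bool) \<Rightarrow> real ^ 'n \<Rightarrow> nat ^ 'n \<Rightarrow> nat ^ 'n \<Rightarrow> bool" where
  "less_a prec a \<alpha> \<beta> \<longleftrightarrow> weight a \<alpha> > weight a \<beta> \<or> weight a \<alpha> = weight a \<beta> \<and> prec \<alpha> \<beta>"

definition leq_a ::
  "(nat ^ 'n \<Rightarrow> nat ^ 'n \<Rightarrow> bool) \<Rightarrow> real ^ 'n \<Rightarrow> nat ^ 'n \<Rightarrow> nat ^ 'n \<Rightarrow> bool" where
  "leq_a prec a \<alpha> \<beta> \<longleftrightarrow> less_a prec a \<alpha> \<beta> \<or> \<alpha> = \<beta>"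

definition max_wrt :: "('b \<Rightarrow> 'b \<Rightarrow> bool) \<Rightarrow> 'b set \<Rightarrow> 'b" where
  "max_wrt lt S = (THE x. x \<in> S \<and> (\<forall>y \<in> S. y = x \<or> lt y x))"

text \<open>The next four definitions are \<open>\<nu>(f, a)\<close>, \<open>in(f, a)\<close>, \<open>exp(f, a)\<close> and \<open>M(f, a)\<close>; they are
  meaningful for \<open>f \<noteq> 0\<close> and \<open>a\<close> with positive entries only.\<close>

definition nu :: "real ^ 'n \<Rightarrow> ('a :: zero, 'n :: finite) mps \<Rightarrow> real" where
  "nu a f = (LEAST w. w \<in> weight a ` supp f)"

definition init_form :: "real ^ 'n \<Rightarrow> ('a :: zero, 'n :: finite) mps \<Rightarrow> ('a, 'n) mps" where
  "init_form a f = Mps (\<lambda>\<alpha>. if \<alpha> \<in> supp f \<and> weight a \<alpha> = nu a f then mcoeff f \<alpha> else 0)"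

definition lexp ::
  "(nat ^ 'n \<Rightarrow> nat ^ 'n \<Rightarrow> bool) \<Rightarrow> real ^ 'n \<Rightarrow> ('a :: zero, 'n :: finite) mps \<Rightarrow> nat ^ 'n" where
  "lexp prec a f = max_wrt prec (supp (init_form a f))"

definition lmon ::
  "(nat ^ 'n \<Rightarrow> nat ^ 'n \<Rightarrow> bool) \<Rightarrow> real ^ 'n \<Rightarrow> ('a :: zero, 'n :: finite) mps \<Rightarrow> ('a, 'n) mps" where
  "lmon prec a f = Mps (\<lambda>\<alpha>. if \<alpha> = lexp prec a f then mcoeff f \<alpha> else 0)"

inductive_set semigroup_gen :: "(nat ^ 'n) set \<Rightarrow> (nat ^ 'n) set" for E where
  zero: "0 \<in> semigroup_gen E"
| gen: "\<alpha> \<in> E \<Longrightarrow> \<alpha> \<in> semigroup_gen E"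
| add: "\<alpha> \<in> semigroup_gen E \<Longrightarrow> \<beta> \<in> semigroup_gen E \<Longrightarrow> \<alpha> + \<beta> \<in> semigroup_gen E"

definition exp_set ::
  "(nat ^ 'n \<Rightarrow> nat ^ 'n \<Rightarrow> bool) \<Rightarrow> real ^ 'n \<Rightarrow> ('a :: comm_ring_1, 'n :: finite) mps set \<Rightarrow>
    (nat ^ 'n) set" where
  "exp_set prec a B = {lexp prec a f | f. f \<in> B \<and> f \<noteq> 0}"

definition canonical_basis ::
  "(nat ^ 'n \<Rightarrow> nat ^ 'n \<Rightarrow> bool) \<Rightarrow> real ^ 'n \<Rightarrow> ('a :: comm_ring_1, 'n :: finite) mps set \<Rightarrow>
    ('a, 'n) mps set \<Rightarrow> bool" where
  "canonical_basis prec a A G \<longleftrightarrow> finite G \<and> G \<subseteq> A \<and> 0 \<notin> G \<and>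
     exp_set prec a A = semigroup_gen (lexp prec a ` G)"


section \<open>Polynomials in \<open>X\<^sub>0, \<dots>, X\<^sub>s\<^sub>-\<^sub>1\<close>\<close>

text \<open>Systems \<open>f\<^sub>1, \<dots>, f\<^sub>s\<close> are lists, indexed from 0. The ring \<open>\<bbbK>[X\<^sub>0, \<dots>, X\<^sub>s\<^sub>-\<^sub>1]\<close> is the subring
  \<open>polys s\<close> of the polynomials in countably many variables, because \<open>s\<close> varies.\<close>

type_synonym 'a mpoly = "(nat \<Rightarrow>\<^sub>0 nat) \<Rightarrow>\<^sub>0 'a"

definition expos :: "nat \<Rightarrow> (nat \<Rightarrow>\<^sub>0 nat) set" where
  "expos s = {m. Poly_Mapping.keys m \<subseteq> {..<s}}"

definition polys :: "nat \<Rightarrow> ('a :: zero) mpoly set" where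
  "polys s = {p. Poly_Mapping.keys p \<subseteq> expos s}"

definition power_prod ::
  "('a :: comm_ring_1, 'n :: finite) mps list \<Rightarrow> (nat \<Rightarrow>\<^sub>0 nat) \<Rightarrow> ('a, 'n) mps" where
  "power_prod gs m = (\<Prod>i < length gs. gs ! i ^ Poly_Mapping.lookup m i)"

text \<open>The algebra morphism on \<open>polys (length gs)\<close> that maps \<open>X\<^sub>i\<close> to \<open>gs ! i\<close>.\<close>

definition peval ::
  "('a :: comm_ring_1, 'n :: finite) mps list \<Rightarrow> 'a mpoly \<Rightarrow> ('a, 'n) mps" where
  "peval gs p = (\<Sum>m \<in> Poly_Mapping.keys p.
     mps_const (Poly_Mapping.lookup p m) * power_prod gs m)"

text \<open>The kernel of \<open>\<phi>\<close>, with \<open>\<phi>(X\<^sub>i) = M(f\<^sub>i, a)\<close>.\<close>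

definition ker_phi ::
  "(nat ^ 'n \<Rightarrow> nat ^ 'n \<Rightarrow> bool) \<Rightarrow> real ^ 'n \<Rightarrow> ('a :: comm_ring_1, 'n :: finite) mps list \<Rightarrow>
    'a mpoly set" where
  "ker_phi prec a fs = {p \<in> polys (length fs). peval (map (lmon prec a) fs) p = 0}"

definition poly_ideal :: "nat \<Rightarrow> ('a :: comm_ring_1) mpoly list \<Rightarrow> 'a mpoly set" where
  "poly_ideal s Ss = {\<Sum>i < length Ss. q i * Ss ! i | q. \<forall>i < length Ss. q i \<in> polys s}"

definition ker_generators ::
  "(nat ^ 'n \<Rightarrow> nat ^ 'n \<Rightarrow> bool) \<Rightarrow> real ^ 'n \<Rightarrow> ('a :: comm_ring_1, 'n :: finite) mps list \<Rightarrow>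
    'a mpoly list \<Rightarrow> bool" where
  "ker_generators prec a fs Ss \<longleftrightarrow> set Ss \<subseteq> polys (length fs) \<and>
     poly_ideal (length fs) Ss = ker_phi prec a fs"

text \<open>Homogeneity for the grading of \<open>\<bbbK>[X\<^sub>0, \<dots>, X\<^sub>s\<^sub>-\<^sub>1]\<close> by \<open>\<nat>\<^sup>n\<close> in which \<open>X\<^sub>i\<close> has degree
  \<open>exp(f\<^sub>i, a)\<close>; \<open>\<phi>\<close> is graded, and the binomials in its kernel are homogeneous.

  Remainders are not unique, and their definition controls the summands of \<open>H\<close> by the exponent of the
  dividend only. For inhomogeneous generators of the kernel the vanishing of remainders is
  therefore not sufficient for a canonical basis: take \<open>n = 1\<close>, \<open>f\<^sub>1 = x\<^sup>2\<close>,
  \<open>f\<^sub>2 = x\<^sup>2 + x\<^sup>4\<close>, \<open>f\<^sub>3 = x\<^sup>6 + x\<^sup>7\<close>, \<open>P = X\<^sub>2 - X\<^sub>1\<close>, \<open>Q = X\<^sub>3 - X\<^sub>1\<^sup>3\<close> and the generators \<open>P + Q\<close>, \<open>P + 2 Q\<close>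
  of the kernel. As \<open>P(f) = f\<^sub>1\<^sup>2\<close>, their values \<open>f\<^sub>1\<^sup>2 + f\<^sub>3 - f\<^sub>1\<^sup>3\<close>, \<open>f\<^sub>1\<^sup>2 + 2 f\<^sub>3 - 2 f\<^sub>1\<^sup>3\<close> have
  remainder 0, but \<open>Q(f) = x\<^sup>7\<close> while all three leading exponents are even.\<close>

definition homogeneous ::
  "(nat ^ 'n \<Rightarrow> nat ^ 'n \<Rightarrow> bool) \<Rightarrow> real ^ 'n \<Rightarrow> ('a :: zero, 'n :: finite) mps list \<Rightarrow>
    'a mpoly \<Rightarrow> bool" where
  "homogeneous prec a fs p \<longleftrightarrow> (\<exists>\<delta>. \<forall>m \<in> Poly_Mapping.keys p.
     (\<Sum>i < length fs. Poly_Mapping.lookup m i *s lexp prec a (fs ! i)) = \<delta>)"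


section \<open>Remainders and the completion process\<close>

text \<open>\<open>is_remainder prec a F Fs R\<close>: \<open>R\<close> is an \<open>a\<close>-remainder of \<open>F\<close> by \<open>Fs\<close>. The sum of the family
  \<open>c\<^sub>\<alpha> F\<^sup>\<alpha>\<close> is taken in the topology above. There may be several remainders.\<close>

definition is_remainder ::
  "(nat ^ 'n \<Rightarrow> nat ^ 'n \<Rightarrow> bool) \<Rightarrow> real ^ 'n \<Rightarrow> ('a :: comm_ring_1, 'n :: finite) mps \<Rightarrow>
    ('a, 'n) mps list \<Rightarrow> ('a, 'n) mps \<Rightarrow> bool" where
  "is_remainder prec a F Fs R \<longleftrightarrow>
    (if F = 0 then R = 0
     else \<exists>H \<in> power_subalg (set Fs).
       F = H + R \<and>
       (H \<noteq> 0 \<and> R \<noteq> 0 \<longrightarrow>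
          lexp prec a F = max_wrt (less_a prec a) {lexp prec a H, lexp prec a R}) \<and>
       (\<exists>c. ((\<lambda>m. mps_const (c m) * power_prod Fs m) has_sum H) (expos (length Fs)) \<and>
          (\<forall>m \<in> expos (length Fs). c m \<noteq> 0 \<longrightarrow>
             leq_a prec a (lexp prec a (power_prod Fs m)) (lexp prec a F)) \<and>
          (R = 0 \<longrightarrow> (\<exists>!m. m \<in> expos (length Fs) \<and> c m \<noteq> 0 \<and>
             lexp prec a F = lexp prec a (power_prod Fs m)))) \<and>
       (R \<noteq> 0 \<longrightarrow> (\<forall>\<beta> \<in> supp R.
          \<beta> \<notin> semigroup_gen (lexp prec a ` set Fs) \<and> leq_a prec a \<beta> (lexp prec a F))))"

definition remainders ::
  "(nat ^ 'n \<Rightarrow> nat ^ 'n \<Rightarrow> bool) \<Rightarrow> real ^ 'n \<Rightarrow> ('a :: comm_ring_1, 'n :: finite) mps list \<Rightarrow>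
    'a mpoly list \<Rightarrow> ('a, 'n) mps list \<Rightarrow> bool" where
  "remainders prec a fs Ss Rs \<longleftrightarrow> length Rs = length Ss \<and>
     (\<forall>i < length Ss. is_remainder prec a (peval fs (Ss ! i)) fs (Rs ! i))"

text \<open>\<open>gs\<close> arises from \<open>fs\<close> by adding the nonzero remainders, listed in any way.\<close>

definition extended_by ::
  "('a :: comm_ring_1, 'n :: finite) mps list \<Rightarrow> ('a, 'n) mps list \<Rightarrow> ('a, 'n) mps list \<Rightarrow>
    bool" where
  "extended_by fs Rs gs \<longleftrightarrow> (\<exists>es. gs = fs @ es \<and> set es = {R \<in> set Rs. R \<noteq> 0})"

definition admissible_choice ::
  "(nat ^ 'n \<Rightarrow> nat ^ 'n \<Rightarrow> bool) \<Rightarrow> real ^ 'n \<Rightarrow> ('a :: comm_ring_1, 'n :: finite) mps list \<Rightarrow>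
    'a mpoly list \<Rightarrow> ('a, 'n) mps list \<Rightarrow> bool" where
  "admissible_choice prec a fs Ss Rs \<longleftrightarrow> ker_generators prec a fs Ss \<and>
     (\<forall>S \<in> set Ss. homogeneous prec a fs S) \<and> remainders prec a fs Ss Rs"

definition process_step ::
  "(nat ^ 'n \<Rightarrow> nat ^ 'n \<Rightarrow> bool) \<Rightarrow> real ^ 'n \<Rightarrow> ('a :: comm_ring_1, 'n :: finite) mps list \<Rightarrow>
    ('a, 'n) mps list \<Rightarrow> bool" where
  "process_step prec a fs gs \<longleftrightarrow>
     (\<exists>Ss Rs. admissible_choice prec a fs Ss Rs \<and> (\<exists>R \<in> set Rs. R \<noteq> 0) \<and> extended_by fs Rs gs)"

definition process_stops ::
  "(nat ^ 'n \<Rightarrow> nat ^ 'n \<Rightarrow> bool) \<Rightarrow> real ^ 'n \<Rightarrow> ('a :: comm_ring_1, 'n :: finite) mps list \<Rightarrow>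
    bool" where
  "process_stops prec a fs \<longleftrightarrow>
     (\<exists>Ss Rs. admissible_choice prec a fs Ss Rs \<and> (\<forall>R \<in> set Rs. R = 0))"

end

theory Submission
  imports Defs
begin

text \<open>
  The proof lowers representations. A series in the subalgebra generated by \<open>f\<^sub>1, \<dots>, f\<^sub>s\<close> is a
  combination of products \<open>f\<^sup>m\<close>; let \<open>\<delta>\<close> bound their leading exponents. If \<open>\<delta>\<close> is the leading exponent
  \<open>e\<close> of the series, then \<open>e\<close> is the leading exponent of a product and so lies in the semigroup of the
  \<open>exp(f\<^sub>i, a)\<close>. Otherwise the leading terms of the products with exponent \<open>\<delta>\<close> cancel. This means that
  the part of degree \<open>\<delta>\<close> of the representing polynomial lies in the kernel of
  \<open>X\<^sub>i \<mapsto> M(f\<^sub>i, a)\<close>, so it is a combination of the homogeneous generators \<open>S\<close> of the kernel. The value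
  of \<open>S\<close> has an exponent below the degree of \<open>S\<close>, and division writes it as a sum of products of no
  larger exponent plus a remainder. Hence, once the nonzero remainders have been added to
  the generators, the same leading exponent \<open>e\<close> is represented with a bound below \<open>\<delta>\<close>
  (\<open>reduction_step\<close>). As the weights are positive, only finitely many exponents lie above \<open>e\<close>, so
  along any chain of such steps \<open>e\<close> enters the semigroup (\<open>span_le_reaches_lexp\<close>,
  \<open>exp_set_covered\<close>). By finiteness of the set of exponents of bounded weight, passing to the closure
  of the subalgebra yields no new leading exponents, and infinite sums may be truncated.

  Applied to a constant chain this shows that a system without nonzero remainders is a canonical
  basis. Applied to an infinite run of the process it shows that the semigroups exhaust
  \<open>exp(A, a)\<close>; but each step enlarges the semigroup, because a remainder has its exponents outside the
  old one, and a finitely generated \<open>exp(A, a)\<close> is reached after finitely many steps.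

  That the process can always be continued until it stops requires two existence results. The kernel
  is generated by binomials, and finitely many of them suffice by Dickson's lemma
  (\<open>kernel_generators_exist\<close>). A remainder is found by solving a triangular system of linear
  equations for the coefficients of the subtracted products (\<open>remainder_exists\<close>).
\<close>

section \<open>Coefficients of power series\<close>

lemma mcoeff_zero [simp]: "mcoeff (0 :: ('a :: comm_ring_1, 'n :: finite) mps) \<alpha> = 0"
  by (simp add: zero_mps_def)

lemma mcoeff_plus [simp]:
  "mcoeff (f + g :: ('a :: comm_ring_1, 'n :: finite) mps) \<alpha> = mcoeff f \<alpha> + mcoeff g \<alpha>"
  by (simp add: plus_mps_def)

lemma mcoeff_minus [simp]:
  "mcoeff (f - g :: ('a :: comm_ring_1, 'n :: finite) mps) \<alpha> = mcoeff f \<alpha> - mcoeff g \<alpha>"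
  by (simp add: minus_mps_def)

lemma mcoeff_mult:
  "mcoeff (f * g :: ('a :: comm_ring_1, 'n :: finite) mps) \<gamma> =
    (\<Sum>(\<alpha>, \<beta>) \<in> splits \<gamma>. mcoeff f \<alpha> * mcoeff g \<beta>)"
  by (simp add: times_mps_def)

lemma mcoeff_sum:
  "mcoeff (\<Sum>i \<in> I. f i :: ('a :: comm_ring_1, 'n :: finite) mps) \<alpha> = (\<Sum>i \<in> I. mcoeff (f i) \<alpha>)"
  by (induction I rule: infinite_finite_induct) auto

lemma mcoeff_const_mult [simp]:
  "mcoeff (mps_const c * f :: ('a :: comm_ring_1, 'n :: finite) mps) \<gamma> = c * mcoeff f \<gamma>"
proof -
  have "mcoeff (mps_const c * f) \<gamma> = (\<Sum>x \<in> splits \<gamma>. if x = (0, \<gamma>) then c * mcoeff f \<gamma> else 0)"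
    unfolding mcoeff_mult mps_const_def mcoeff_Mps
  proof (rule sum.cong)
    fix x assume "x \<in> splits \<gamma>"
    then show "(case x of (\<alpha>, \<beta>) \<Rightarrow> (if \<alpha> = 0 then c else 0) * mcoeff f \<beta>) =
        (if x = (0, \<gamma>) then c * mcoeff f \<gamma> else 0)"
      by (cases x; cases "fst x = 0") simp_all
  qed simp
  also have "\<dots> = c * mcoeff f \<gamma>"
    by (subst sum.delta) auto
  finally show ?thesis .
qed

lemma mps_const_arith:
  fixes c d :: "'a :: comm_ring_1"
  shows "(mps_const 0 :: ('a, 'n :: finite) mps) = 0"
    and "(mps_const 1 :: ('a, 'n :: finite) mps) = 1"
    and "(mps_const (c + d) :: ('a, 'n :: finite) mps) = mps_const c + mps_const d"
    and "(mps_const (c * d) :: ('a, 'n :: finite) mps) = mps_const c * mps_const d"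
proof -
  show "(mps_const 0 :: ('a, 'n) mps) = 0" "(mps_const 1 :: ('a, 'n) mps) = 1"
    "(mps_const (c + d) :: ('a, 'n) mps) = mps_const c + mps_const d"
    by (auto intro!: mps_eqI simp: mps_const_def one_mps_def)
  show "(mps_const (c * d) :: ('a, 'n) mps) = mps_const c * mps_const d"
    by (rule mps_eqI) (simp, simp add: mps_const_def)
qed

lemma supp_zero [simp]: "supp (0 :: ('a :: comm_ring_1, 'n :: finite) mps) = {}"
  by (simp add: supp_def)

lemma supp_eq_empty [simp]: "supp (f :: ('a :: comm_ring_1, 'n :: finite) mps) = {} \<longleftrightarrow> f = 0"
  by (auto simp: supp_def intro: mps_eqI)

lemma supp_plus: "supp (f + g :: ('a :: comm_ring_1, 'n :: finite) mps) \<subseteq> supp f \<union> supp g"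
  by (auto simp: supp_def)

lemma supp_const_mult:
  "supp (mps_const c * f :: ('a :: comm_ring_1, 'n :: finite) mps) \<subseteq> supp f"
  by (auto simp: supp_def)

lemma supp_mult:
  assumes "\<gamma> \<in> supp (f * g :: ('a :: comm_ring_1, 'n :: finite) mps)"
  obtains \<alpha> \<beta> where "\<alpha> \<in> supp f" "\<beta> \<in> supp g" "\<gamma> = \<alpha> + \<beta>"
proof -
  have "(\<Sum>x \<in> splits \<gamma>. mcoeff f (fst x) * mcoeff g (snd x)) \<noteq> 0"
    using assms by (simp add: supp_def mcoeff_mult split_def)
  then obtain x where "x \<in> splits \<gamma>" "mcoeff f (fst x) * mcoeff g (snd x) \<noteq> 0"
    by (rule sum.not_neutral_contains_not_neutral)
  then obtain \<alpha> \<beta> where "(\<alpha>, \<beta>) \<in> splits \<gamma>" "mcoeff f \<alpha> * mcoeff g \<beta> \<noteq> 0"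
    by (cases x) auto
  moreover from this have "mcoeff f \<alpha> \<noteq> 0" "mcoeff g \<beta> \<noteq> 0"
    by force+
  ultimately show thesis
    using that[of \<alpha> \<beta>] by (simp add: supp_def)
qed

text \<open>Both the neighbourhoods of the topology and the truncations at a given weight compare series
  on a set of exponents that is closed under passing to summands. Such a comparison is a ring
  congruence, because a coefficient of a product involves only smaller exponents of the factors.\<close>

definition agree ::
  "(nat ^ 'n) set \<Rightarrow> ('a :: comm_ring_1, 'n :: finite) mps \<Rightarrow> ('a, 'n) mps \<Rightarrow> bool" where
  "agree \<Delta> f g \<longleftrightarrow> (\<forall>\<alpha> \<in> \<Delta>. mcoeff f \<alpha> = mcoeff g \<alpha>)"

definition summand_closed :: "(nat ^ 'n) set \<Rightarrow> bool" where
  "summand_closed \<Delta> \<longleftrightarrow> (\<forall>\<alpha> \<beta>. \<alpha> + \<beta> \<in> \<Delta> \<longrightarrow> \<alpha> \<in> \<Delta>)"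

lemma agree_refl [simp]: "agree \<Delta> f f"
  by (simp add: agree_def)

lemma agree_add: "agree \<Delta> f f' \<Longrightarrow> agree \<Delta> g g' \<Longrightarrow> agree \<Delta> (f + g) (f' + g')"
  by (simp add: agree_def)

lemma agree_mult:
  assumes "summand_closed \<Delta>" "agree \<Delta> f f'" "agree \<Delta> g g'"
  shows "agree \<Delta> (f * g) (f' * g')"
  unfolding agree_def mcoeff_mult
proof (intro ballI sum.cong refl)
  fix \<gamma> x
  assume \<gamma>: "\<gamma> \<in> \<Delta>" "x \<in> splits \<gamma>"
  then obtain \<alpha> \<beta> where x: "x = (\<alpha>, \<beta>)" "\<alpha> + \<beta> \<in> \<Delta>" "\<beta> + \<alpha> \<in> \<Delta>"
    by (auto simp: add.commute)
  then have "\<alpha> \<in> \<Delta>" "\<beta> \<in> \<Delta>"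
    using assms(1) unfolding summand_closed_def by blast+
  then show "(case x of (\<alpha>, \<beta>) \<Rightarrow> mcoeff f \<alpha> * mcoeff g \<beta>) =
      (case x of (\<alpha>, \<beta>) \<Rightarrow> mcoeff f' \<alpha> * mcoeff g' \<beta>)"
    using assms(2,3) by (simp add: x agree_def)
qed


section \<open>The topology and closed subalgebras\<close>

abbreviation low_degree :: "nat \<Rightarrow> (nat ^ 'n) set" where
  "low_degree N \<equiv> {\<alpha>. (\<Sum>i \<in> UNIV. \<alpha> $ i) < N}"

lemma summand_closed_low_degree: "summand_closed (low_degree N)"
  by (auto simp: summand_closed_def sum.distrib)

lemma finite_subset_low_degree:
  assumes "finite (\<Delta> :: (nat ^ 'n :: finite) set)"
  obtains N where "\<Delta> \<subseteq> low_degree N"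
proof
  show "\<Delta> \<subseteq> low_degree (Suc (Max ((\<lambda>\<alpha>. \<Sum>i \<in> UNIV. \<alpha> $ i) ` \<Delta>)))"
    using assms by (auto simp: less_Suc_eq_le)
qed

lemma open_agree_low_degree: "open {g. agree (low_degree N) g f}"
  unfolding open_mps_def agree_def by (auto intro!: exI[of _ N])

lemma open_mps_iff: "open U \<longleftrightarrow> (\<forall>f \<in> U. \<exists>N. \<forall>g. agree (low_degree N) g f \<longrightarrow> g \<in> U)"
  unfolding open_mps_def agree_def by simp

lemma mem_closure_mps_iff:
  "f \<in> closure S \<longleftrightarrow> (\<forall>N. \<exists>g \<in> S. agree (low_degree N) g f)"
proof
  assume f: "f \<in> closure S"
  show "\<forall>N. \<exists>g \<in> S. agree (low_degree N) g f"
  proof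
    fix N
    have "{g. agree (low_degree N) g f} \<inter> closure S \<noteq> {}"
      using f agree_refl by blast
    then have "{g. agree (low_degree N) g f} \<inter> S \<noteq> {}"
      using open_Int_closure_eq_empty[OF open_agree_low_degree] by blast
    then show "\<exists>g \<in> S. agree (low_degree N) g f"
      by blast
  qed
next
  assume *: "\<forall>N. \<exists>g \<in> S. agree (low_degree N) g f"
  show "f \<in> closure S"
  proof (rule ccontr)
    assume "f \<notin> closure S"
    then obtain N where "\<forall>g. agree (low_degree N) g f \<longrightarrow> g \<in> - closure S"
      using closed_closure[of S] unfolding closed_def open_mps_iff by blast
    with * show False
      using closure_subset by blast
  qed
qed

lemma has_sum_mps_iff:
  fixes F :: "'i \<Rightarrow> ('a :: comm_ring_1, 'n :: finite) mps"
  shows "(F has_sum H) I \<longleftrightarrow> (\<forall>N. \<exists>X. finite X \<and> X \<subseteq> I \<and>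
    (\<forall>Y. finite Y \<longrightarrow> X \<subseteq> Y \<longrightarrow> Y \<subseteq> I \<longrightarrow> agree (low_degree N) (sum F Y) H))"
proof -
  have "(F has_sum H) I \<longleftrightarrow>
    (\<forall>N. \<forall>\<^sub>F Y in finite_subsets_at_top I. agree (low_degree N) (sum F Y) H)"
    unfolding has_sum_def tendsto_def
  proof safe
    fix N
    assume "\<forall>S. open S \<longrightarrow> H \<in> S \<longrightarrow> (\<forall>\<^sub>F Y in finite_subsets_at_top I. sum F Y \<in> S)"
    then show "\<forall>\<^sub>F Y in finite_subsets_at_top I. agree (low_degree N) (sum F Y) H"
      using open_agree_low_degree[of N H] by auto
  next
    fix S :: "('a, 'n) mps set"
    assume *: "\<forall>N. \<forall>\<^sub>F Y in finite_subsets_at_top I. agree (low_degree N) (sum F Y) H"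
      and S: "open S" "H \<in> S"
    then obtain N where N: "\<And>g. agree (low_degree N) g H \<Longrightarrow> g \<in> S"
      unfolding open_mps_iff by blast
    show "\<forall>\<^sub>F Y in finite_subsets_at_top I. sum F Y \<in> S"
      by (rule eventually_mono[OF *[rule_format, of N]]) (rule N)
  qed
  then show ?thesis
    unfolding eventually_finite_subsets_at_top by (simp only: imp_conjL)
qed

lemma subalg_sum: "(\<And>i. i \<in> I \<Longrightarrow> f i \<in> subalg S) \<Longrightarrow> sum f I \<in> subalg S"
  by (induction I rule: infinite_finite_induct)
    (auto intro: subalg.add subalg.const[of 0, unfolded mps_const_arith])

lemma subalg_subset_power_subalg: "subalg S \<subseteq> power_subalg S"
  unfolding power_subalg_def by (rule closure_subset)

lemma power_subalg_add:
  assumes "f \<in> power_subalg S" "g \<in> power_subalg S"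
  shows "f + g \<in> power_subalg S"
  unfolding power_subalg_def mem_closure_mps_iff
proof
  fix N
  obtain f' g' where "f' \<in> subalg S" "agree (low_degree N) f' f"
    "g' \<in> subalg S" "agree (low_degree N) g' g"
    using assms unfolding power_subalg_def mem_closure_mps_iff by blast
  then show "\<exists>h \<in> subalg S. agree (low_degree N) h (f + g)"
    by (intro bexI[of _ "f' + g'"] agree_add subalg.add)
qed

lemma power_subalg_mult:
  assumes "f \<in> power_subalg S" "g \<in> power_subalg S"
  shows "f * g \<in> power_subalg S"
  unfolding power_subalg_def mem_closure_mps_iff
proof
  fix N
  obtain f' g' where "f' \<in> subalg S" "agree (low_degree N) f' f"
    "g' \<in> subalg S" "agree (low_degree N) g' g"
    using assms unfolding power_subalg_def mem_closure_mps_iff by blast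
  then show "\<exists>h \<in> subalg S. agree (low_degree N) h (f * g)"
    by (intro bexI[of _ "f' * g'"] agree_mult summand_closed_low_degree subalg.mult)
qed

lemma power_subalg_minus:
  assumes "f \<in> power_subalg S" "g \<in> power_subalg S"
  shows "f - g \<in> power_subalg S"
proof -
  have "f - g = f + mps_const (- 1) * g"
    by (rule mps_eqI) simp
  moreover have "mps_const (- 1) \<in> power_subalg S"
    using subalg_subset_power_subalg subalg.const by blast
  ultimately show ?thesis
    using assms by (metis power_subalg_add power_subalg_mult)
qed

lemma power_subalg_least:
  assumes "T \<subseteq> power_subalg S"
  shows "power_subalg T \<subseteq> power_subalg S"
proof -
  have "f \<in> power_subalg S" if "f \<in> subalg T" for f
    using that
  proof induction
    case (const c)
    then show ?case
      using subalg_subset_power_subalg subalg.const by blast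
  next
    case (gen f)
    then show ?case
      using assms by blast
  qed (simp_all add: power_subalg_add power_subalg_mult)
  then have "closure (subalg T) \<subseteq> closure (power_subalg S)"
    by (intro closure_mono) blast
  then show ?thesis
    by (simp add: power_subalg_def)
qed

lemma has_sum_mem_power_subalg:
  assumes "(F has_sum H) I" "\<And>i. i \<in> I \<Longrightarrow> F i \<in> subalg S"
  shows "H \<in> power_subalg S"
  unfolding power_subalg_def mem_closure_mps_iff
proof
  fix N
  obtain X where "X \<subseteq> I" "agree (low_degree N) (sum F X) H"
    using assms(1) unfolding has_sum_mps_iff by blast
  then show "\<exists>g \<in> subalg S. agree (low_degree N) g H"
    using subalg_sum[of X F S] assms(2) by blast
qed


section \<open>Products of generators and evaluation of polynomials\<close>

inductive_set prods :: "('a :: comm_ring_1, 'n :: finite) mps set \<Rightarrow> ('a, 'n) mps set" for G where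
  one: "1 \<in> prods G"
| mult: "g \<in> G \<Longrightarrow> P \<in> prods G \<Longrightarrow> g * P \<in> prods G"

lemma prods_mult: "P \<in> prods G \<Longrightarrow> Q \<in> prods G \<Longrightarrow> P * Q \<in> prods G"
  by (induction rule: prods.induct) (auto simp: mult.assoc intro: prods.mult)

lemma prods_gen: "g \<in> G \<Longrightarrow> g \<in> prods G"
  using prods.mult[OF _ prods.one] by force

lemma prods_mono:
  assumes "G \<subseteq> G'"
  shows "prods G \<subseteq> prods G'"
proof
  fix P assume "P \<in> prods G"
  then show "P \<in> prods G'"
    by induction (use assms in \<open>auto intro: prods.intros\<close>)
qed

lemma prods_power: "P \<in> prods G \<Longrightarrow> P ^ k \<in> prods G"
  by (induction k) (auto intro: prods.one prods_mult)

lemma prods_prod: "(\<And>i. i \<in> I \<Longrightarrow> f i \<in> prods G) \<Longrightarrow> prod f I \<in> prods G"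
  by (induction I rule: infinite_finite_induct) (auto intro: prods.one prods_mult)

lemma prods_subset_subalg: "prods G \<subseteq> subalg G"
proof
  fix P assume "P \<in> prods G"
  then show "P \<in> subalg G"
    by induction (auto intro: subalg.gen subalg.mult subalg.const[of 1, unfolded mps_const_arith])
qed

inductive_set lincomb :: "('a :: comm_ring_1, 'n :: finite) mps set \<Rightarrow> ('a, 'n) mps set" for B where
  zero: "0 \<in> lincomb B"
| step: "P \<in> B \<Longrightarrow> v \<in> lincomb B \<Longrightarrow> mps_const c * P + v \<in> lincomb B"

lemma lincomb_add: "u \<in> lincomb B \<Longrightarrow> v \<in> lincomb B \<Longrightarrow> u + v \<in> lincomb B"
  by (induction rule: lincomb.induct) (auto simp: add.assoc intro: lincomb.step)

lemma lincomb_base: "P \<in> B \<Longrightarrow> mps_const c * P \<in> lincomb B"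
  using lincomb.step[OF _ lincomb.zero] by force

lemma lincomb_sum: "(\<And>i. i \<in> I \<Longrightarrow> f i \<in> lincomb B) \<Longrightarrow> sum f I \<in> lincomb B"
  by (induction I rule: infinite_finite_induct) (auto intro: lincomb.zero lincomb_add)

lemma lincomb_mono:
  assumes "B \<subseteq> B'"
  shows "lincomb B \<subseteq> lincomb B'"
proof
  fix v assume "v \<in> lincomb B"
  then show "v \<in> lincomb B'"
    by induction (use assms in \<open>auto intro: lincomb.intros\<close>)
qed

lemma lincomb_mult_left:
  assumes "v \<in> lincomb B" "\<And>P. P \<in> B \<Longrightarrow> Q * P \<in> B'"
  shows "mps_const c * Q * v \<in> lincomb B'"
  using assms(1)
proof induction
  case zero
  then show ?case
    by (simp add: lincomb.zero)
next
  case (step P v d)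
  have "mps_const (c * d) * (Q * P) + mps_const c * Q * v \<in> lincomb B'"
    using step assms(2) by (intro lincomb.step) auto
  then show ?case
    by (simp add: mps_const_arith algebra_simps)
qed

lemma subalg_subset_lincomb_prods: "subalg G \<subseteq> lincomb (prods G)"
proof
  fix f assume "f \<in> subalg G"
  then show "f \<in> lincomb (prods G)"
  proof induction
    case (const c)
    then show ?case
      using lincomb_base[OF prods.one] by force
  next
    case (gen f)
    then show ?case
      using lincomb_base[OF prods_gen, of f G 1] by (simp add: mps_const_arith)
  next
    case (add f g)
    then show ?case
      by (simp add: lincomb_add)
  next
    case (mult f g)
    have "f * g \<in> lincomb (prods G)"
      using mult.IH(1)
    proof induction
      case zero
      then show ?case
        by (simp add: lincomb.zero)
    next
      case (step P v c)
      have "mps_const c * P * g \<in> lincomb (prods G)"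
        using mult.IH(2) by (rule lincomb_mult_left) (use step in \<open>auto intro: prods_mult\<close>)
      then show ?case
        using step by (simp add: algebra_simps lincomb_add)
    qed
    then show ?case .
  qed
qed

lemma power_prod_0 [simp]: "power_prod gs 0 = 1"
  by (simp add: power_prod_def)

lemma power_prod_add: "power_prod gs (m + l) = power_prod gs m * power_prod gs l"
  by (simp add: power_prod_def lookup_add power_add prod.distrib)

lemma power_prod_single: "i < length gs \<Longrightarrow> power_prod gs (Poly_Mapping.single i 1) = gs ! i"
proof -
  assume i: "i < length gs"
  have "power_prod gs (Poly_Mapping.single i 1) = (\<Prod>j < length gs. if i = j then gs ! j else 1)"
    unfolding power_prod_def by (intro prod.cong) (auto simp: lookup_single when_def)
  then show ?thesis
    using i by simp
qed

lemma expos_0 [simp]: "0 \<in> expos s"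
  by (simp add: expos_def)

lemma expos_add: "m \<in> expos s \<Longrightarrow> l \<in> expos s \<Longrightarrow> m + l \<in> expos s"
  using Poly_Mapping.keys_add[of m l] by (auto simp: expos_def)

lemma expos_single: "i < s \<Longrightarrow> Poly_Mapping.single i c \<in> expos s"
  by (simp add: expos_def)

lemma power_prod_mem_prods: "power_prod gs m \<in> prods (set gs)"
  unfolding power_prod_def by (intro prods_prod prods_power prods_gen) auto

lemma prods_set_eq: "prods (set gs) = power_prod gs ` expos (length gs)"
proof
  show "prods (set gs) \<subseteq> power_prod gs ` expos (length gs)"
  proof
    fix P assume "P \<in> prods (set gs)"
    then show "P \<in> power_prod gs ` expos (length gs)"
    proof induction
      case one
      then show ?case
        by (intro image_eqI[of _ _ 0]) auto
    next
      case (mult g P)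
      then obtain i m where "i < length gs" "g = gs ! i" "P = power_prod gs m" "m \<in> expos (length gs)"
        by (auto simp: in_set_conv_nth)
      then show ?case
        by (intro image_eqI[of _ _ "Poly_Mapping.single i 1 + m"])
          (simp_all add: power_prod_add power_prod_single expos_add expos_single del: One_nat_def)
    qed
  qed
qed (auto simp: power_prod_mem_prods)

text \<open>The freedom in \<open>\<phi>\<close> serves two linear maps: evaluation, and evaluation of a single homogeneous
  component, where \<open>\<phi>\<close> vanishes on the monomials of all other degrees.\<close>

definition lin_ext ::
  "((nat \<Rightarrow>\<^sub>0 nat) \<Rightarrow> ('a :: comm_ring_1, 'n :: finite) mps) \<Rightarrow> 'a mpoly \<Rightarrow> ('a, 'n) mps" where
  "lin_ext \<phi> p = (\<Sum>m \<in> Poly_Mapping.keys p. mps_const (Poly_Mapping.lookup p m) * \<phi> m)"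

lemma peval_eq_lin_ext: "peval gs = lin_ext (power_prod gs)"
  by (simp add: fun_eq_iff peval_def lin_ext_def)

lemma lin_ext_superset:
  assumes "finite X" "Poly_Mapping.keys p \<subseteq> X"
  shows "lin_ext \<phi> p = (\<Sum>m \<in> X. mps_const (Poly_Mapping.lookup p m) * \<phi> m)"
  unfolding lin_ext_def
  by (rule sum.mono_neutral_left) (use assms in \<open>auto simp: in_keys_iff mps_const_arith\<close>)

lemma lin_ext_zero [simp]: "lin_ext \<phi> 0 = 0"
  by (simp add: lin_ext_def)

lemma lin_ext_add: "lin_ext \<phi> (p + q) = lin_ext \<phi> p + lin_ext \<phi> q"
proof -
  let ?X = "Poly_Mapping.keys p \<union> Poly_Mapping.keys q"
  have "lin_ext \<phi> r = (\<Sum>m \<in> ?X. mps_const (Poly_Mapping.lookup r m) * \<phi> m)"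
    if "r \<in> {p, q, p + q}" for r
    by (rule lin_ext_superset) (use that Poly_Mapping.keys_add[of p q] in auto)
  then show ?thesis
    by (simp add: lookup_add mps_const_arith algebra_simps sum.distrib)
qed

lemma lin_ext_sum: "lin_ext \<phi> (\<Sum>i \<in> I. p i) = (\<Sum>i \<in> I. lin_ext \<phi> (p i))"
  by (induction I rule: infinite_finite_induct) (auto simp: lin_ext_add)

lemma lin_ext_single: "lin_ext \<phi> (Poly_Mapping.single m c) = mps_const c * \<phi> m"
  using lin_ext_superset[of "{m}" "Poly_Mapping.single m c" \<phi>] by (simp split: if_splits)

lemma poly_mapping_eq_sum_single:
  "p = (\<Sum>m \<in> Poly_Mapping.keys p. Poly_Mapping.single m (Poly_Mapping.lookup p m))"
proof (rule poly_mapping_eqI)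
  fix k
  have "(\<Sum>m \<in> Poly_Mapping.keys p. Poly_Mapping.lookup (Poly_Mapping.single m (Poly_Mapping.lookup p m)) k)
      = (\<Sum>m \<in> Poly_Mapping.keys p. if m = k then Poly_Mapping.lookup p m else 0)"
    by (intro sum.cong) (auto simp: lookup_single when_def)
  also have "\<dots> = Poly_Mapping.lookup p k"
    by (simp add: in_keys_iff)
  finally show "Poly_Mapping.lookup p k = Poly_Mapping.lookup
      (\<Sum>m \<in> Poly_Mapping.keys p. Poly_Mapping.single m (Poly_Mapping.lookup p m)) k"
    by (simp add: lookup_sum)
qed

lemma lin_ext_mult:
  "lin_ext \<phi> (q * p) = (\<Sum>m \<in> Poly_Mapping.keys q. \<Sum>l \<in> Poly_Mapping.keys p.
    mps_const (Poly_Mapping.lookup q m * Poly_Mapping.lookup p l) * \<phi> (m + l))"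
proof -
  have "q * p = (\<Sum>m \<in> Poly_Mapping.keys q. \<Sum>l \<in> Poly_Mapping.keys p.
      Poly_Mapping.single (m + l) (Poly_Mapping.lookup q m * Poly_Mapping.lookup p l))"
    by (subst poly_mapping_eq_sum_single[of q], subst poly_mapping_eq_sum_single[of p])
      (simp add: sum_product mult_single)
  then show ?thesis
    by (simp add: lin_ext_sum lin_ext_single)
qed

lemma peval_mult: "peval gs (q * p) = peval gs q * peval gs p"
  unfolding peval_eq_lin_ext lin_ext_mult unfolding lin_ext_def sum_product
  by (intro sum.cong refl) (simp add: power_prod_add mps_const_arith ac_simps)

lemma peval_mem_subalg: "peval gs p \<in> subalg (set gs)"
  unfolding peval_def
  by (intro subalg_sum subalg.mult subalg.const)
    (use power_prod_mem_prods prods_subset_subalg in blast)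

lemma lincomb_power_prod:
  assumes "v \<in> lincomb (power_prod gs ` M)"
  obtains p where "Poly_Mapping.keys p \<subseteq> M" "v = peval gs p"
proof -
  have "\<exists>p. Poly_Mapping.keys p \<subseteq> M \<and> v = peval gs p"
    using assms
  proof induction
    case zero
    then show ?case
      by (intro exI[of _ 0]) (simp add: peval_def)
  next
    case (step P v c)
    then obtain m p where "m \<in> M" "P = power_prod gs m" "Poly_Mapping.keys p \<subseteq> M" "v = peval gs p"
      by blast
    then show ?case
      using Poly_Mapping.keys_add[of "Poly_Mapping.single m c" p]
      by (intro exI[of _ "Poly_Mapping.single m c + p"])
        (auto simp: peval_eq_lin_ext lin_ext_add lin_ext_single split: if_splits)
  qed
  then show thesis
    using that by blast
qed


section \<open>Leading exponents\<close>

locale weighted_order =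
  fixes prec :: "nat ^ 'n :: finite \<Rightarrow> nat ^ 'n \<Rightarrow> bool" and a :: "real ^ 'n"
  assumes prec: "monomial_order prec" and a_pos: "a $ i > 0"
begin

abbreviation lt (infix "\<sqsubset>" 50) where "\<alpha> \<sqsubset> \<beta> \<equiv> less_a prec a \<alpha> \<beta>"
abbreviation le (infix "\<sqsubseteq>" 50) where "\<alpha> \<sqsubseteq> \<beta> \<equiv> leq_a prec a \<alpha> \<beta>"
abbreviation lx :: "('k :: field, 'n) mps \<Rightarrow> nat ^ 'n" where "lx \<equiv> lexp prec a"

lemma prec_rules:
  "\<not> prec \<alpha> \<alpha>" "prec \<alpha> \<beta> \<Longrightarrow> prec \<beta> \<gamma> \<Longrightarrow> prec \<alpha> \<gamma>" "\<alpha> \<noteq> \<beta> \<Longrightarrow> prec \<alpha> \<beta> \<or> prec \<beta> \<alpha>"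
  "prec \<alpha> \<beta> \<Longrightarrow> prec (\<alpha> + \<gamma>) (\<beta> + \<gamma>)"
proof -
  have *: "irreflp prec" "transp prec" "totalp prec"
    "\<forall>\<alpha> \<beta> \<gamma>. prec \<alpha> \<beta> \<longrightarrow> prec (\<alpha> + \<gamma>) (\<beta> + \<gamma>)"
    using prec unfolding monomial_order_def by auto
  show "\<not> prec \<alpha> \<alpha>"
    using *(1) by (rule irreflpD)
  show "prec \<alpha> \<gamma>" if "prec \<alpha> \<beta>" "prec \<beta> \<gamma>"
    using *(2) that by (rule transpD)
  show "prec \<alpha> \<beta> \<or> prec \<beta> \<alpha>" if "\<alpha> \<noteq> \<beta>"
    using *(3) that by (rule totalpD)
  show "prec (\<alpha> + \<gamma>) (\<beta> + \<gamma>)" if "prec \<alpha> \<beta>"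
    using *(4) that by blast
qed

sublocale ord: linorder le lt
proof
  fix \<alpha> \<beta> \<gamma> :: "nat ^ 'n"
  show "\<alpha> \<sqsubset> \<beta> \<longleftrightarrow> \<alpha> \<sqsubseteq> \<beta> \<and> \<not> \<beta> \<sqsubseteq> \<alpha>"
    unfolding leq_a_def less_a_def using prec_rules(1,2) by (smt (verit))
  show "\<alpha> \<sqsubseteq> \<alpha>"
    by (simp add: leq_a_def)
  show "\<alpha> \<sqsubseteq> \<gamma>" if "\<alpha> \<sqsubseteq> \<beta>" "\<beta> \<sqsubseteq> \<gamma>"
    using that unfolding leq_a_def less_a_def using prec_rules(2) by (smt (verit))
  show "\<alpha> = \<beta>" if "\<alpha> \<sqsubseteq> \<beta>" "\<beta> \<sqsubseteq> \<alpha>"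
    using that unfolding leq_a_def less_a_def using prec_rules(1,2) by (smt (verit))
  show "\<alpha> \<sqsubseteq> \<beta> \<or> \<beta> \<sqsubseteq> \<alpha>"
    unfolding leq_a_def less_a_def using prec_rules(3) by (smt (verit))
qed

lemma weight_add [simp]: "weight a (\<alpha> + \<beta>) = weight a \<alpha> + weight a \<beta>"
  by (simp add: weight_def algebra_simps sum.distrib)

lemma weight_nonneg: "weight a \<alpha> \<ge> 0"
  unfolding weight_def by (intro sum_nonneg mult_nonneg_nonneg) (auto intro: less_imp_le a_pos)

lemma le_imp_weight_le: "\<alpha> \<sqsubseteq> \<beta> \<Longrightarrow> weight a \<beta> \<le> weight a \<alpha>"
  by (auto simp: leq_a_def less_a_def)

lemma lt_add_right: "\<alpha> \<sqsubset> \<beta> \<Longrightarrow> \<alpha> + \<gamma> \<sqsubset> \<beta> + \<gamma>"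
  by (auto simp: less_a_def prec_rules(4))

lemma lt_add_left: "\<alpha> \<sqsubset> \<beta> \<Longrightarrow> \<gamma> + \<alpha> \<sqsubset> \<gamma> + \<beta>"
  using lt_add_right by (simp add: add.commute)

lemma le_add_mono: "\<alpha> \<sqsubseteq> \<beta> \<Longrightarrow> \<gamma> \<sqsubseteq> \<delta> \<Longrightarrow> \<alpha> + \<gamma> \<sqsubseteq> \<beta> + \<delta>"
  by (metis leq_a_def lt_add_left lt_add_right ord.order.trans)

lemma add_eq_of_le:
  assumes "\<alpha> \<sqsubseteq> \<alpha>'" "\<beta> \<sqsubseteq> \<beta>'" "\<alpha> + \<beta> = \<alpha>' + \<beta>'"
  shows "\<alpha> = \<alpha>'" "\<beta> = \<beta>'"
proof -
  show "\<alpha> = \<alpha>'"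
  proof (rule ccontr)
    assume "\<alpha> \<noteq> \<alpha>'"
    then have "\<alpha> + \<beta> \<sqsubset> \<alpha>' + \<beta>"
      using assms(1) by (simp add: leq_a_def lt_add_right)
    also have "\<alpha>' + \<beta> \<sqsubseteq> \<alpha>' + \<beta>'"
      using assms(2) by (simp add: le_add_mono)
    finally show False
      using assms(3) by simp
  qed
  then show "\<beta> = \<beta>'"
    using assms(3) by simp
qed

text \<open>As the entries of \<open>a\<close> are positive, only finitely many exponents have bounded weight. Hence
  every nonempty set has a largest element, and every descent that stays above a fixed exponent
  is finite.\<close>

lemma finite_weight_le: "finite {\<gamma>. weight a \<gamma> \<le> w}"
proof -
  have "{\<gamma>. weight a \<gamma> \<le> w} \<subseteq> {\<gamma>. \<forall>i. \<gamma> $ i \<le> (\<chi> i. nat \<lceil>w / a $ i\<rceil>) $ i}"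
  proof safe
    fix \<gamma> i assume w: "weight a \<gamma> \<le> w"
    have "a $ i * real (\<gamma> $ i) \<le> weight a \<gamma>"
      unfolding weight_def
      by (rule member_le_sum) (simp_all add: less_imp_le[OF a_pos])
    then have "real (\<gamma> $ i) \<le> w / a $ i"
      using w a_pos[of i] by (simp add: field_simps)
    then show "\<gamma> $ i \<le> (\<chi> i. nat \<lceil>w / a $ i\<rceil>) $ i"
      by simp linarith
  qed
  then show ?thesis
    using finite_below_vec by (rule finite_subset)
qed

lemma finite_above: "finite {\<gamma>. \<delta> \<sqsubseteq> \<gamma>}"
  by (rule finite_subset[OF _ finite_weight_le[of "weight a \<delta>"]]) (auto dest: le_imp_weight_le)

lemma wfp_gt: "wfp (\<lambda>\<alpha> \<beta>. \<beta> \<sqsubset> \<alpha>)"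
proof (rule wfp_if_convertible_to_nat[of _ "\<lambda>\<delta>. card {\<gamma>. \<delta> \<sqsubseteq> \<gamma>}"])
  fix \<alpha> \<beta> assume "\<beta> \<sqsubset> \<alpha>"
  then have "{\<gamma>. \<alpha> \<sqsubseteq> \<gamma>} \<subset> {\<gamma>. \<beta> \<sqsubseteq> \<gamma>}"
    by (auto dest: ord.order.strict_implies_order ord.order.trans ord.order.strict_trans1)
  then show "card {\<gamma>. \<alpha> \<sqsubseteq> \<gamma>} < card {\<gamma>. \<beta> \<sqsubseteq> \<gamma>}"
    using finite_above by (rule psubset_card_mono[rotated])
qed

lemma has_greatest:
  assumes "S \<noteq> {}"
  shows "\<exists>e \<in> S. \<forall>\<beta> \<in> S. \<beta> \<sqsubseteq> e"
proof -
  obtain e where "e \<in> S" "\<And>\<beta>. e \<sqsubset> \<beta> \<Longrightarrow> \<beta> \<notin> S"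
    using wfp_gt[unfolded wfp_iff_ex_minimal] assms by blast
  then show ?thesis
    using ord.not_less by blast
qed

abbreviation down :: "nat ^ 'n \<Rightarrow> (nat ^ 'n) set" where "down \<delta> \<equiv> {\<beta>. \<beta> \<sqsubseteq> \<delta>}"

lemma lexp_eqI:
  assumes "e \<in> supp f" "supp f \<subseteq> down e"
  shows "lx f = e"
proof -
  have "nu a f = weight a e"
    unfolding nu_def by (rule Least_equality) (use assms in \<open>auto dest: le_imp_weight_le\<close>)
  then have s: "supp (init_form a f) = {\<alpha> \<in> supp f. weight a \<alpha> = weight a e}"
    by (auto simp: init_form_def supp_def)
  have e: "y = e \<or> prec y e" if "y \<in> supp f" "weight a y = weight a e" for y
    using assms(2) that by (auto simp: leq_a_def less_a_def)
  show ?thesis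
    unfolding lexp_def max_wrt_def s
  proof (rule the_equality)
    fix x
    assume "x \<in> {\<alpha> \<in> supp f. weight a \<alpha> = weight a e} \<and>
      (\<forall>y \<in> {\<alpha> \<in> supp f. weight a \<alpha> = weight a e}. y = x \<or> prec y x)"
    then have "x = e \<or> prec x e" "x = e \<or> prec e x"
      using e assms(1) by auto
    then show "x = e"
      using prec_rules(1,2) by metis
  qed (use e assms(1) in auto)
qed

lemma lexp_greatest:
  assumes "f \<noteq> 0"
  shows "lx f \<in> supp f" "supp f \<subseteq> down (lx f)"
proof -
  obtain e where "e \<in> supp f" "\<forall>\<beta> \<in> supp f. \<beta> \<sqsubseteq> e"
    using has_greatest[of "supp f"] assms by auto
  moreover from this have "lx f = e"
    by (intro lexp_eqI) auto
  ultimately show "lx f \<in> supp f" "supp f \<subseteq> down (lx f)"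
    by auto
qed

lemma supp_mult_down:
  assumes "supp f \<subseteq> down \<alpha>" "supp g \<subseteq> down \<beta>"
  shows "supp (f * g) \<subseteq> down (\<alpha> + \<beta>)"
proof
  fix \<gamma> assume "\<gamma> \<in> supp (f * g)"
  then show "\<gamma> \<in> down (\<alpha> + \<beta>)"
    by (rule supp_mult) (use assms in \<open>auto intro: le_add_mono\<close>)
qed

lemma mcoeff_mult_top:
  assumes "supp f \<subseteq> down \<alpha>" "supp g \<subseteq> down \<beta>"
  shows "mcoeff (f * g) (\<alpha> + \<beta>) = mcoeff f \<alpha> * mcoeff g \<beta>"
proof -
  have "mcoeff (f * g) (\<alpha> + \<beta>) =
      (\<Sum>x \<in> splits (\<alpha> + \<beta>). if x = (\<alpha>, \<beta>) then mcoeff f \<alpha> * mcoeff g \<beta> else 0)"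
    unfolding mcoeff_mult
  proof (rule sum.cong)
    fix x assume x: "x \<in> splits (\<alpha> + \<beta>)"
    show "(case x of (\<alpha>, \<beta>) \<Rightarrow> mcoeff f \<alpha> * mcoeff g \<beta>) =
        (if x = (\<alpha>, \<beta>) then mcoeff f \<alpha> * mcoeff g \<beta> else 0)"
    proof (cases "fst x \<in> supp f \<and> snd x \<in> supp g")
      case True
      then have "fst x \<sqsubseteq> \<alpha>" "snd x \<sqsubseteq> \<beta>" "fst x + snd x = \<alpha> + \<beta>"
        using assms x by auto
      then have "fst x = \<alpha>" "snd x = \<beta>"
        by (rule add_eq_of_le)+
      then show ?thesis
        by (cases x) simp
    qed (auto simp: supp_def split: prod.splits)
  qed simp
  then show ?thesis
    by simp
qed

lemma lexp_mult:
  assumes "f \<noteq> 0" "g \<noteq> 0"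
  shows "f * g \<noteq> 0" "lx (f * g) = lx f + lx g"
    "mcoeff (f * g) (lx f + lx g) = mcoeff f (lx f) * mcoeff g (lx g)"
proof -
  note * = lexp_greatest[OF assms(1)] lexp_greatest[OF assms(2)]
  show c: "mcoeff (f * g) (lx f + lx g) = mcoeff f (lx f) * mcoeff g (lx g)"
    by (rule mcoeff_mult_top) (use * in auto)
  then have e: "lx f + lx g \<in> supp (f * g)"
    using * by (simp add: supp_def)
  then show "f * g \<noteq> 0"
    by auto
  show "lx (f * g) = lx f + lx g"
    by (rule lexp_eqI[OF e supp_mult_down]) (use * in auto)
qed

lemma lexp_one: "lx 1 = 0"
  by (rule lexp_eqI) (auto simp: supp_def one_mps_def)

text \<open>This is what links the kernel to cancellation of leading terms: the morphism with
  \<open>X\<^sub>i \<mapsto> M(f\<^sub>i, a)\<close> sends \<open>X\<^sup>m\<close> to the leading monomial of its value at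
  \<open>f\<^sub>1, \<dots>, f\<^sub>s\<close>.\<close>

lemma lmon_mult:
  fixes f g :: "('k :: field, 'n) mps"
  assumes "f \<noteq> 0" "g \<noteq> 0"
  shows "lmon prec a (f * g) = lmon prec a f * lmon prec a g"
proof (rule mps_eqI)
  fix \<gamma>
  have s: "supp (lmon prec a h) \<subseteq> {lx h}" "supp (lmon prec a h) \<subseteq> down (lx h)" for h :: "('k, 'n) mps"
    by (auto simp: supp_def lmon_def)
  show "mcoeff (lmon prec a (f * g)) \<gamma> = mcoeff (lmon prec a f * lmon prec a g) \<gamma>"
  proof (cases "\<gamma> = lx f + lx g")
    case True
    have "mcoeff (lmon prec a f * lmon prec a g) \<gamma> = mcoeff f (lx f) * mcoeff g (lx g)"
      using mcoeff_mult_top[OF s(2) s(2), of f g] by (simp add: True lmon_def)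
    then show ?thesis
      using lexp_mult[OF assms] True by (simp add: lmon_def)
  next
    case False
    then have "\<gamma> \<notin> supp (lmon prec a f * lmon prec a g)"
      using s(1) by (auto elim!: supp_mult)
    then show ?thesis
      using False lexp_mult(2)[OF assms] by (simp add: lmon_def supp_def)
  qed
qed

lemma lmon_one: "lmon prec a (1 :: ('k :: field, 'n) mps) = 1"
  unfolding lmon_def lexp_one by (rule mps_eqI) (simp add: one_mps_def)

abbreviation pdeg :: "('k :: field, 'n) mps list \<Rightarrow> (nat \<Rightarrow>\<^sub>0 nat) \<Rightarrow> nat ^ 'n" where
  "pdeg gs m \<equiv> (\<Sum>i < length gs. Poly_Mapping.lookup m i *s lx (gs ! i))"

lemma pdeg_add: "pdeg gs (m + l) = pdeg gs m + pdeg gs l"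
  by (simp add: lookup_add vec.scale_left_distrib sum.distrib vector_sadd_rdistrib)

lemma power_lexp:
  assumes "f \<noteq> 0"
  shows "f ^ k \<noteq> 0 \<and> lx (f ^ k) = k *s lx f \<and> lmon prec a (f ^ k) = lmon prec a f ^ k"
proof (induction k)
  case 0
  then show ?case
    by (simp add: lexp_one lmon_one)
next
  case (Suc k)
  then have "lx (f ^ Suc k) = lx f + k *s lx f"
    using assms by (simp add: lexp_mult)
  also have "\<dots> = Suc k *s lx f"
    by (simp add: vec_eq_iff)
  finally show ?case
    using Suc assms by (simp add: lexp_mult(1) lmon_mult)
qed

lemma power_prod_lexp:
  assumes "0 \<notin> set gs"
  shows "power_prod gs m \<noteq> 0" "lx (power_prod gs m) = pdeg gs m"
    "power_prod (map (lmon prec a) gs) m = lmon prec a (power_prod gs m)"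
proof -
  have "(\<Prod>i \<in> I. gs ! i ^ Poly_Mapping.lookup m i) \<noteq> 0 \<and>
    lx (\<Prod>i \<in> I. gs ! i ^ Poly_Mapping.lookup m i) = (\<Sum>i \<in> I. Poly_Mapping.lookup m i *s lx (gs ! i)) \<and>
    lmon prec a (\<Prod>i \<in> I. gs ! i ^ Poly_Mapping.lookup m i) =
      (\<Prod>i \<in> I. lmon prec a (gs ! i) ^ Poly_Mapping.lookup m i)"
    if "finite I" "I \<subseteq> {..<length gs}" for I
    using that
  proof induction
    case empty
    then show ?case
      by (simp add: lexp_one lmon_one)
  next
    case (insert i I)
    have "gs ! i \<noteq> 0"
      using insert.prems assms by (metis insert_subset lessThan_iff nth_mem)
    note p = power_lexp[OF this, of "Poly_Mapping.lookup m i"]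
    show ?case
      using insert p by (simp add: lexp_mult(1,2) lmon_mult)
  qed
  from this[of "{..<length gs}"] show "power_prod gs m \<noteq> 0" "lx (power_prod gs m) = pdeg gs m"
    "power_prod (map (lmon prec a) gs) m = lmon prec a (power_prod gs m)"
    by (simp_all add: power_prod_def)
qed

lemma prods_nonzero:
  fixes P :: "('k :: field, 'n) mps"
  assumes "P \<in> prods G" "0 \<notin> G"
  shows "P \<noteq> 0"
  using assms
proof induction
  case (mult g P)
  then show ?case
    by (intro lexp_mult(1)) auto
qed simp

lemma semigroup_gen_eq_lexp_prods:
  assumes "0 \<notin> G"
  shows "semigroup_gen (lx ` G) = lx ` prods G"
proof
  show "semigroup_gen (lx ` G) \<subseteq> lx ` prods G"
  proof
    fix \<gamma> assume "\<gamma> \<in> semigroup_gen (lx ` G)"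
    then show "\<gamma> \<in> lx ` prods G"
    proof induction
      case zero
      then show ?case
        by (metis image_eqI lexp_one prods.one)
    next
      case (gen \<alpha>)
      then show ?case
        by (auto intro: prods_gen)
    next
      case (add \<alpha> \<beta>)
      then obtain P Q where "P \<in> prods G" "Q \<in> prods G" "\<alpha> = lx P" "\<beta> = lx Q"
        by blast
      then show ?case
        using assms by (metis image_eqI lexp_mult(2) prods_mult prods_nonzero)
    qed
  qed
  show "lx ` prods G \<subseteq> semigroup_gen (lx ` G)"
  proof safe
    fix P assume "P \<in> prods G"
    then show "lx P \<in> semigroup_gen (lx ` G)"
    proof induction
      case one
      then show ?case
        by (simp add: lexp_one semigroup_gen.zero)
    next
      case (mult g P)
      then have "lx (g * P) = lx g + lx P"
        using assms prods_nonzero[of P G] by (intro lexp_mult) auto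
      then show ?case
        using mult by (auto intro: semigroup_gen.intros)
    qed
  qed
qed

lemma semigroup_gen_subset_exp_set:
  assumes "0 \<notin> G" "G \<subseteq> power_subalg S"
  shows "semigroup_gen (lx ` G) \<subseteq> exp_set prec a (power_subalg S)"
proof -
  have "prods G \<subseteq> power_subalg S"
    using prods_subset_subalg subalg_subset_power_subalg power_subalg_least[OF assms(2)] by blast
  then show ?thesis
    unfolding semigroup_gen_eq_lexp_prods[OF assms(1)] exp_set_def
    using prods_nonzero[OF _ assms(1)] by blast
qed

text \<open>The exponents of weight at most that of \<open>lx f\<close> are all that decides the leading exponent, and
  there are finitely many of them. So closures and infinite sums can be truncated to polynomial
  expressions without changing it.\<close>

lemma lexp_agree:
  assumes "f \<noteq> 0" "agree {\<alpha>. weight a \<alpha> \<le> weight a (lx f)} g f"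
  shows "g \<noteq> 0" "lx g = lx f"
proof -
  note * = lexp_greatest[OF assms(1)]
  have e: "lx f \<in> supp g"
    using assms(2) *(1) by (simp add: agree_def supp_def)
  then show "g \<noteq> 0"
    by auto
  have "\<beta> \<sqsubseteq> lx f" if "\<beta> \<in> supp g" for \<beta>
  proof (cases "weight a \<beta> \<le> weight a (lx f)")
    case True
    then have "\<beta> \<in> supp f"
      using that assms(2) by (simp add: agree_def supp_def)
    then show ?thesis
      using * by auto
  qed (auto simp: leq_a_def less_a_def)
  then show "lx g = lx f"
    using e by (intro lexp_eqI) auto
qed

lemma exp_set_power_subalg:
  fixes S :: "('k :: field, 'n) mps set"
  shows "exp_set prec a (power_subalg S) = {lx f | f. f \<in> subalg S \<and> f \<noteq> 0}"
proof -
  have "\<exists>g. lx f = lx g \<and> g \<in> subalg S \<and> g \<noteq> 0" if f: "f \<in> power_subalg S" "f \<noteq> 0" for f :: "('k, 'n) mps"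
  proof -
    obtain N where "{\<alpha>. weight a \<alpha> \<le> weight a (lx f)} \<subseteq> low_degree N"
      using finite_subset_low_degree[OF finite_weight_le] .
    moreover obtain g where "g \<in> subalg S" "agree (low_degree N) g f"
      using f(1) unfolding power_subalg_def mem_closure_mps_iff by blast
    ultimately have "agree {\<alpha>. weight a \<alpha> \<le> weight a (lx f)} g f"
      by (auto simp: agree_def)
    then show ?thesis
      using lexp_agree[OF f(2)] \<open>g \<in> subalg S\<close> by metis
  qed
  then show ?thesis
    unfolding exp_set_def using subalg_subset_power_subalg by blast
qed

end


section \<open>Lowering the degree of a representation\<close>

lemma supp_lincomb:
  assumes "v \<in> lincomb B"
  shows "supp v \<subseteq> (\<Union>P \<in> B. supp P)"
  using assms
proof induction
  case (step P v c)
  then show ?case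
    using supp_plus[of "mps_const c * P" v] supp_const_mult[of c P] by blast
qed simp

lemma sum_mem_additive:
  assumes "0 \<in> W" "\<And>g h. g \<in> W \<Longrightarrow> h \<in> W \<Longrightarrow> g + h \<in> W" "\<And>i. i \<in> I \<Longrightarrow> h i \<in> W"
  shows "sum h I \<in> W"
  using assms(3) by (induction I rule: infinite_finite_induct) (auto intro: assms(1,2))

lemma poly_ideal_gen:
  fixes Ss :: "'a :: comm_ring_1 mpoly list"
  assumes "i < length Ss"
  shows "Ss ! i \<in> poly_ideal s Ss"
proof -
  define q :: "nat \<Rightarrow> 'a mpoly" where "q j = (if j = i then 1 else 0)" for j
  have "Ss ! i = (\<Sum>j < length Ss. q j * Ss ! j)"
    using assms by (simp add: q_def if_distrib[of "\<lambda>x. x * _"] cong: if_cong)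
  moreover have "\<forall>j < length Ss. q j \<in> polys s"
    by (simp add: polys_def q_def)
  ultimately show ?thesis
    unfolding poly_ideal_def by blast
qed

context weighted_order
begin

text \<open>The bound \<open>\<delta>\<close> belongs to the representation and not to the series: the leading exponent of a
  combination may be much smaller than those of the products in it, because leading terms can
  cancel. The argument lowers \<open>\<delta>\<close> until it meets the leading exponent.\<close>

definition span_le :: "('k :: field, 'n) mps set \<Rightarrow> nat ^ 'n \<Rightarrow> ('k, 'n) mps set" where
  "span_le G \<delta> = lincomb {P \<in> prods G. lx P \<sqsubseteq> \<delta>}"

definition span_lt :: "('k :: field, 'n) mps set \<Rightarrow> nat ^ 'n \<Rightarrow> ('k, 'n) mps set" where
  "span_lt G \<delta> = lincomb {P \<in> prods G. lx P \<sqsubset> \<delta>}"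

lemma supp_prods:
  assumes "P \<in> prods G" "0 \<notin> G"
  shows "supp P \<subseteq> down (lx P)"
  using lexp_greatest(2) prods_nonzero assms by blast

lemma supp_span_le:
  assumes "v \<in> span_le G \<delta>" "0 \<notin> G"
  shows "supp v \<subseteq> down \<delta>"
proof
  fix \<beta> assume "\<beta> \<in> supp v"
  then obtain P where P: "P \<in> prods G" "lx P \<sqsubseteq> \<delta>" "\<beta> \<in> supp P"
    using supp_lincomb[of v] assms(1) unfolding span_le_def by blast
  then have "\<beta> \<sqsubseteq> lx P"
    using supp_prods assms(2) by blast
  then show "\<beta> \<in> down \<delta>"
    using P(2) by auto
qed

lemma subalg_span_le:
  assumes "f \<in> subalg G"
  obtains \<delta> where "f \<in> span_le G \<delta>"
proof -
  have "\<exists>\<delta>. f \<in> span_le G \<delta>" if "f \<in> lincomb (prods G)"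
    using that
  proof induction
    case zero
    then show ?case
      by (auto simp: span_le_def intro: lincomb.zero)
  next
    case (step P v c)
    then obtain \<delta> where v: "v \<in> span_le G \<delta>"
      by blast
    define \<delta>' where "\<delta>' = ord.max (lx P) \<delta>"
    have "v \<in> span_le G \<delta>'"
      using v lincomb_mono[of "{P \<in> prods G. lx P \<sqsubseteq> \<delta>}" "{P \<in> prods G. lx P \<sqsubseteq> \<delta>'}"]
      unfolding span_le_def \<delta>'_def by (auto simp: ord.le_max_iff_disj)
    moreover have "P \<in> {P \<in> prods G. lx P \<sqsubseteq> \<delta>'}"
      using step by (simp add: \<delta>'_def)
    ultimately show ?case
      unfolding span_le_def by (blast intro: lincomb.step)
  qed
  then show thesis
    using that assms subalg_subset_lincomb_prods by blast
qed

lemma mcoeff_lmon_power_prod: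
  assumes "0 \<notin> set gs"
  shows "mcoeff (power_prod (map (lmon prec a) gs) m) \<gamma> =
    (if \<gamma> = pdeg gs m then mcoeff (power_prod gs m) \<gamma> else 0)"
  unfolding power_prod_lexp(3)[OF assms] lmon_def power_prod_lexp(2)[OF assms] by simp

lemma mcoeff_peval:
  "mcoeff (peval gs p) \<gamma> =
    (\<Sum>m \<in> Poly_Mapping.keys p. Poly_Mapping.lookup p m * mcoeff (power_prod gs m) \<gamma>)"
  by (simp add: peval_def mcoeff_sum)

lemma supp_power_prod:
  assumes "0 \<notin> set gs"
  shows "supp (power_prod gs m) \<subseteq> down (pdeg gs m)"
  using lexp_greatest(2)[OF power_prod_lexp(1)[OF assms]] power_prod_lexp(2)[OF assms] by metis

text \<open>For a homogeneous \<open>S\<close> the image under \<open>X\<^sub>i \<mapsto> M(f\<^sub>i, a)\<close> is exactly the term of exponent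
  \<open>d\<close> in \<open>S(f\<^sub>1, \<dots>, f\<^sub>s)\<close>, and no larger exponent occurs in that value.\<close>

lemma supp_peval_kernel:
  assumes gs: "0 \<notin> set gs"
    and S: "peval (map (lmon prec a) gs) S = 0"
    and d: "\<And>m. m \<in> Poly_Mapping.keys S \<Longrightarrow> pdeg gs m = d"
  shows "supp (peval gs S) \<subseteq> {\<gamma>. \<gamma> \<sqsubset> d}"
proof
  fix \<gamma> assume \<gamma>: "\<gamma> \<in> supp (peval gs S)"
  have "(\<Sum>m \<in> Poly_Mapping.keys S. Poly_Mapping.lookup S m * mcoeff (power_prod gs m) \<gamma>) \<noteq> 0"
    using \<gamma> by (simp add: supp_def mcoeff_peval)
  then obtain m where m: "m \<in> Poly_Mapping.keys S"
    "Poly_Mapping.lookup S m * mcoeff (power_prod gs m) \<gamma> \<noteq> 0"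
    by (rule sum.not_neutral_contains_not_neutral)
  then have "\<gamma> \<sqsubseteq> d"
    using supp_power_prod[OF gs, of m] d[OF m(1)] by (auto simp: supp_def)
  moreover have "\<gamma> \<noteq> d"
  proof
    assume "\<gamma> = d"
    then have "mcoeff (peval gs S) \<gamma> = mcoeff (peval (map (lmon prec a) gs) S) \<gamma>"
      unfolding mcoeff_peval mcoeff_lmon_power_prod[OF gs] by (intro sum.cong) (use d in auto)
    then show False
      using \<gamma> S by (simp add: supp_def)
  qed
  ultimately show "\<gamma> \<in> {\<gamma>. \<gamma> \<sqsubset> d}"
    by (simp add: ord.le_less)
qed

text \<open>Only the monomials of degree \<open>\<delta>\<close> contribute to the coefficient at \<open>\<delta>\<close>; as it vanishes, their
  part \<open>p\<close> of the representation is in the kernel. The value of \<open>p\<close> is written with the linear map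
  that ignores the other degrees. When \<open>p\<close> is expressed by generators of the kernel with arbitrary
  polynomial coefficients, this map selects the summands of degree \<open>\<delta>\<close>, so the coefficients need
  not be made homogeneous first.\<close>

lemma split_top_component:
  fixes f :: "('k :: field, 'n) mps"
  assumes gs: "0 \<notin> set gs"
    and f: "f \<in> span_le (set gs) \<delta>" "mcoeff f \<delta> = 0"
  obtains p g where "p \<in> ker_phi prec a gs" "g \<in> span_lt (set gs) \<delta>"
    "f = lin_ext (\<lambda>m. if pdeg gs m = \<delta> then power_prod gs m else 0) p + g"
proof -
  let ?s = "length gs" and ?\<psi> = "\<lambda>m. if pdeg gs m = \<delta> then power_prod gs m else 0"
  have "{P \<in> prods (set gs). lx P \<sqsubseteq> \<delta>} = power_prod gs ` {m \<in> expos ?s. pdeg gs m \<sqsubseteq> \<delta>}"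
    by (auto simp: prods_set_eq power_prod_lexp(2)[OF gs])
  then have "f \<in> lincomb (power_prod gs ` {m \<in> expos ?s. pdeg gs m \<sqsubseteq> \<delta>})"
    using f(1) by (simp add: span_le_def)
  then obtain q where q: "Poly_Mapping.keys q \<subseteq> {m \<in> expos ?s. pdeg gs m \<sqsubseteq> \<delta>}" "f = peval gs q"
    by (rule lincomb_power_prod)
  define X where "X = {m \<in> Poly_Mapping.keys q. pdeg gs m = \<delta>}"
  define Y where "Y = {m \<in> Poly_Mapping.keys q. pdeg gs m \<noteq> \<delta>}"
  define p where "p = (\<Sum>m \<in> X. Poly_Mapping.single m (Poly_Mapping.lookup q m))"
  define g where "g = (\<Sum>m \<in> Y. mps_const (Poly_Mapping.lookup q m) * power_prod gs m)"
  have XY: "Poly_Mapping.keys q = X \<union> Y" "X \<inter> Y = {}" "finite X" "finite Y"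
    unfolding X_def Y_def by auto
  have lin: "lin_ext \<theta> p = (\<Sum>m \<in> X. mps_const (Poly_Mapping.lookup q m) * \<theta> m)"
    for \<theta> :: "_ \<Rightarrow> ('k, 'n) mps"
    by (simp add: p_def lin_ext_sum lin_ext_single)
  have "lin_ext ?\<psi> p = (\<Sum>m \<in> X. mps_const (Poly_Mapping.lookup q m) * power_prod gs m)"
    unfolding lin by (intro sum.cong) (auto simp: X_def)
  then have 1: "f = lin_ext ?\<psi> p + g"
    unfolding q(2) peval_def g_def XY(1) using XY by (simp add: sum.union_disjoint)
  have 2: "g \<in> span_lt (set gs) \<delta>"
    unfolding g_def span_lt_def
    by (intro lincomb_sum lincomb_base)
      (use q(1) in \<open>auto simp: Y_def power_prod_mem_prods power_prod_lexp(2)[OF gs] ord.less_le\<close>)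
  have "Poly_Mapping.keys p \<subseteq> X"
    unfolding p_def using Poly_Mapping.keys_sum by (fastforce split: if_splits)
  then have "p \<in> polys ?s"
    using q(1) by (auto simp: polys_def X_def)
  moreover have "peval (map (lmon prec a) gs) p = 0"
  proof (rule mps_eqI)
    fix \<gamma>
    have e: "mcoeff (peval (map (lmon prec a) gs) p) \<gamma> = (\<Sum>m \<in> X. Poly_Mapping.lookup q m *
        (if \<gamma> = \<delta> then mcoeff (power_prod gs m) \<gamma> else 0))"
      unfolding peval_eq_lin_ext lin mcoeff_sum mcoeff_const_mult mcoeff_lmon_power_prod[OF gs]
      by (intro sum.cong) (auto simp: X_def)
    also have "\<dots> = 0"
    proof (cases "\<gamma> = \<delta>")
      case True
      have "mcoeff (power_prod gs m) \<delta> = 0" if "m \<in> Y" for m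
      proof (rule ccontr)
        assume "mcoeff (power_prod gs m) \<delta> \<noteq> 0"
        then have "\<delta> \<sqsubseteq> pdeg gs m"
          using supp_power_prod[OF gs, of m] by (auto simp: supp_def)
        then show False
          using that q(1) ord.order.antisym unfolding Y_def by blast
      qed
      then have "(\<Sum>m \<in> X. Poly_Mapping.lookup q m * mcoeff (power_prod gs m) \<delta>) = mcoeff f \<delta>"
        unfolding q(2) mcoeff_peval XY(1) using XY by (simp add: sum.union_disjoint)
      then show ?thesis
        using True f(2) by simp
    qed simp
    finally show "mcoeff (peval (map (lmon prec a) gs) p) \<gamma> = mcoeff 0 \<gamma>"
      by simp
  qed
  ultimately have "p \<in> ker_phi prec a gs"
    by (simp add: ker_phi_def)
  then show thesis
    using that 1 2 by blast
qed

lemma lin_ext_component_mult: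
  assumes d: "\<And>m. m \<in> Poly_Mapping.keys S \<Longrightarrow> pdeg gs m = d"
  shows "lin_ext (\<lambda>m. if pdeg gs m = \<delta> then power_prod gs m else 0) (q * S) =
    (\<Sum>m \<in> {m \<in> Poly_Mapping.keys q. pdeg gs m + d = \<delta>}.
      mps_const (Poly_Mapping.lookup q m) * power_prod gs m * peval gs S)"
proof -
  have "lin_ext (\<lambda>m. if pdeg gs m = \<delta> then power_prod gs m else 0) (q * S) =
    (\<Sum>m \<in> Poly_Mapping.keys q. if pdeg gs m + d = \<delta> then
      mps_const (Poly_Mapping.lookup q m) * power_prod gs m * peval gs S else 0)"
    unfolding lin_ext_mult
  proof (rule sum.cong[OF refl])
    fix m
    have "(\<Sum>l \<in> Poly_Mapping.keys S. mps_const (Poly_Mapping.lookup q m * Poly_Mapping.lookup S l) *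
        (if pdeg gs (m + l) = \<delta> then power_prod gs (m + l) else 0)) =
      (\<Sum>l \<in> Poly_Mapping.keys S. if pdeg gs m + d = \<delta> then
        mps_const (Poly_Mapping.lookup q m) * power_prod gs m *
          (mps_const (Poly_Mapping.lookup S l) * power_prod gs l) else 0)"
      by (intro sum.cong refl)
        (simp add: pdeg_add d power_prod_add mps_const_arith ac_simps)
    then show "(\<Sum>l \<in> Poly_Mapping.keys S. mps_const (Poly_Mapping.lookup q m * Poly_Mapping.lookup S l) *
        (if pdeg gs (m + l) = \<delta> then power_prod gs (m + l) else 0)) =
      (if pdeg gs m + d = \<delta> then
        mps_const (Poly_Mapping.lookup q m) * power_prod gs m * peval gs S else 0)"
      by (simp add: peval_def sum_distrib_left)
  qed
  then show ?thesis
    by (simp add: sum.inter_filter)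
qed

text \<open>The value \<open>F\<close> of a kernel element of degree \<open>d\<close> is \<open>H + R\<close>, where the summands of \<open>H\<close> and the
  new generator \<open>R\<close> have exponents at most that of \<open>F\<close>, hence below \<open>d\<close>. Multiplication by a
  monomial of degree \<open>\<delta> - d\<close> keeps this strict. The infinite sum \<open>H\<close> is cut off beyond a weight \<open>w\<close>
  to get a finite combination.\<close>

lemma remainder_approx:
  assumes gs: "0 \<notin> set gs" and R: "is_remainder prec a F gs R" and F: "F \<noteq> 0" "supp F \<subseteq> {\<gamma>. \<gamma> \<sqsubset> d}"
    and G': "set gs \<subseteq> G'" "R \<noteq> 0 \<Longrightarrow> R \<in> G'" and m: "pdeg gs m + d = \<delta>"
  shows "\<exists>v \<in> span_lt G' \<delta>. agree {\<alpha>. weight a \<alpha> \<le> w} v (mps_const c * power_prod gs m * F)"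
proof -
  obtain H c' where H: "F = H + R"
    "((\<lambda>l. mps_const (c' l) * power_prod gs l) has_sum H) (expos (length gs))"
    "\<And>l. l \<in> expos (length gs) \<Longrightarrow> c' l \<noteq> 0 \<Longrightarrow> lx (power_prod gs l) \<sqsubseteq> lx F"
    "R \<noteq> 0 \<Longrightarrow> \<beta> \<in> supp R \<Longrightarrow> \<beta> \<sqsubseteq> lx F" for \<beta>
    using R F(1) unfolding is_remainder_def by auto
  have lt: "lx F \<sqsubset> d"
    using F lexp_greatest(1) by blast
  have lower: "lx (power_prod gs m * Q) \<sqsubset> \<delta>" if "Q \<noteq> 0" "lx Q \<sqsubseteq> lx F" for Q
  proof -
    have "lx (power_prod gs m * Q) = pdeg gs m + lx Q"
      using lexp_mult(2)[OF power_prod_lexp(1)[OF gs] that(1), of m]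
      by (simp add: power_prod_lexp(2)[OF gs])
    also have "\<dots> \<sqsubset> pdeg gs m + d"
      using that(2) lt by (intro lt_add_left) (rule ord.order.strict_trans1)
    finally show ?thesis
      by (simp add: m)
  qed
  have pm: "power_prod gs m \<in> prods G'"
    using power_prod_mem_prods prods_mono[OF G'(1)] by blast
  obtain N where N: "{\<alpha>. weight a \<alpha> \<le> w} \<subseteq> low_degree N"
    using finite_subset_low_degree[OF finite_weight_le] .
  obtain X where X: "X \<subseteq> expos (length gs)"
    "agree (low_degree N) (\<Sum>l \<in> X. mps_const (c' l) * power_prod gs l) H"
    using H(2) unfolding has_sum_mps_iff by blast
  define H' where "H' = (\<Sum>l \<in> X. mps_const (c' l) * power_prod gs l)"
  have "agree {\<alpha>. weight a \<alpha> \<le> w} H' H"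
    using X(2) N by (auto simp: agree_def H'_def)
  moreover have "summand_closed {\<alpha>. weight a \<alpha> \<le> w}"
    unfolding summand_closed_def using weight_nonneg by (simp add: add_increasing2) (smt (verit) weight_nonneg)
  ultimately have "agree {\<alpha>. weight a \<alpha> \<le> w} (mps_const c * power_prod gs m * (H' + R))
      (mps_const c * power_prod gs m * F)"
    unfolding H(1) by (intro agree_mult agree_add) auto
  moreover have "mps_const c * power_prod gs m * (H' + R) \<in> span_lt G' \<delta>"
  proof -
    have "H' \<in> lincomb {P \<in> prods (set gs). lx P \<sqsubseteq> lx F}"
      unfolding H'_def
    proof (rule lincomb_sum)
      fix l assume "l \<in> X"
      then show "mps_const (c' l) * power_prod gs l \<in> lincomb {P \<in> prods (set gs). lx P \<sqsubseteq> lx F}"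
        using X(1) H(3)[of l] power_prod_mem_prods[of gs l]
        by (cases "c' l = 0") (auto simp: mps_const_arith intro: lincomb.zero lincomb_base)
    qed
    then have "mps_const c * power_prod gs m * H' \<in> span_lt G' \<delta>"
      unfolding span_lt_def
    proof (rule lincomb_mult_left)
      fix P assume P: "P \<in> {P \<in> prods (set gs). lx P \<sqsubseteq> lx F}"
      then have "P \<noteq> 0"
        using prods_nonzero gs by blast
      then show "power_prod gs m * P \<in> {P \<in> prods G'. lx P \<sqsubset> \<delta>}"
        using P pm prods_mono[OF G'(1)] lower by (auto intro: prods_mult)
    qed
    moreover have "mps_const c * power_prod gs m * R \<in> span_lt G' \<delta>"
    proof (cases "R = 0")
      case False
      then have "lx R \<sqsubseteq> lx F"
        using H(4) lexp_greatest(1) by blast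
      then have "power_prod gs m * R \<in> {P \<in> prods G'. lx P \<sqsubset> \<delta>}"
        using False pm lower G'(2) by (auto intro: prods_mult prods_gen)
      then show ?thesis
        unfolding span_lt_def mult.assoc by (rule lincomb_base)
    qed (simp add: span_lt_def lincomb.zero)
    ultimately show ?thesis
      unfolding span_lt_def by (simp add: distrib_left lincomb_add)
  qed
  ultimately show ?thesis
    by blast
qed

text \<open>The core of the proof. In a representation with bound \<open>\<delta>\<close> above the leading exponent, the part
  of degree \<open>\<delta>\<close> is a combination of the kernel generators; substituting the division of their
  values replaces it by terms of smaller exponent. Homogeneity of the generators is essential:
  the summands of the division are bounded by the exponent of the dividend, and only for
  homogeneous generators is that exponent below the degree of the monomials that are replaced.\<close>

lemma reduction_step:
  assumes gs: "0 \<notin> set gs" and adm: "admissible_choice prec a gs Ss Rs"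
    and G': "set gs \<subseteq> G'" "{R \<in> set Rs. R \<noteq> 0} \<subseteq> G'"
    and f: "f \<in> span_le (set gs) \<delta>" "f \<noteq> 0" "lx f \<sqsubset> \<delta>"
  obtains f' where "f' \<in> span_lt G' \<delta>" "f' \<noteq> 0" "lx f' = lx f"
proof -
  let ?s = "length gs" and ?\<psi> = "\<lambda>m. if pdeg gs m = \<delta> then power_prod gs m else 0"
  let ?\<Delta> = "{\<alpha>. weight a \<alpha> \<le> weight a (lx f)}"
  \<comment> \<open>The series that have a representation below \<open>\<delta>\<close> up to terms too heavy to affect \<open>lx f\<close>. This is an
    additive group, so \<open>f \<in> W\<close> can be checked on the summands of \<open>f\<close>.\<close>
  define W where "W = {g. \<exists>v \<in> span_lt G' \<delta>. agree ?\<Delta> v g}"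
  have W0: "0 \<in> W"
    unfolding W_def span_lt_def using lincomb.zero agree_refl by blast
  have Wadd: "g + h \<in> W" if "g \<in> W" "h \<in> W" for g h
    using that unfolding W_def span_lt_def by (blast intro: lincomb_add agree_add)
  note Wsum = sum_mem_additive[OF W0 Wadd]
  have "mcoeff f \<delta> = 0"
    using lexp_greatest(2)[OF f(2)] f(3) by (auto simp: supp_def)
  then obtain p g where p: "p \<in> ker_phi prec a gs" "g \<in> span_lt (set gs) \<delta>" "f = lin_ext ?\<psi> p + g"
    using split_top_component[OF gs f(1)] by blast
  have ker: "poly_ideal ?s Ss = ker_phi prec a gs" "set Ss \<subseteq> polys ?s"
    using adm unfolding admissible_choice_def ker_generators_def by auto
  obtain q where q: "p = (\<Sum>i < length Ss. q i * Ss ! i)"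
    using p(1) unfolding ker(1)[symmetric] poly_ideal_def by blast
  have "lin_ext ?\<psi> (q i * Ss ! i) \<in> W" if i: "i < length Ss" for i
  proof -
    let ?S = "Ss ! i"
    obtain d where d: "\<And>m. m \<in> Poly_Mapping.keys ?S \<Longrightarrow> pdeg gs m = d"
      using adm i unfolding admissible_choice_def homogeneous_def by (meson nth_mem)
    have "?S \<in> poly_ideal ?s Ss"
      using i by (rule poly_ideal_gen)
    then have "peval (map (lmon prec a) gs) ?S = 0"
      unfolding ker(1) ker_phi_def by blast
    then have small: "supp (peval gs ?S) \<subseteq> {\<gamma>. \<gamma> \<sqsubset> d}"
      using supp_peval_kernel[OF gs _ d] by blast
    have R: "is_remainder prec a (peval gs ?S) gs (Rs ! i)" "Rs ! i \<in> set Rs"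
      using adm i unfolding admissible_choice_def remainders_def by auto
    have "mps_const c * power_prod gs m * peval gs ?S \<in> W" if m: "pdeg gs m + d = \<delta>" for c m
    proof (cases "peval gs ?S = 0")
      case False
      then show ?thesis
        unfolding W_def using remainder_approx[OF gs R(1) False small G'(1) _ m] R(2) G'(2) by blast
    qed (simp add: W0)
    then have "(\<Sum>m \<in> {m \<in> Poly_Mapping.keys (q i). pdeg gs m + d = \<delta>}.
        mps_const (Poly_Mapping.lookup (q i) m) * power_prod gs m * peval gs ?S) \<in> W"
      by (intro Wsum) auto
    moreover have "lin_ext ?\<psi> (q i * ?S) =
      (\<Sum>m \<in> {m \<in> Poly_Mapping.keys (q i). pdeg gs m + d = \<delta>}.
        mps_const (Poly_Mapping.lookup (q i) m) * power_prod gs m * peval gs ?S)"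
      by (rule lin_ext_component_mult) (rule d)
    ultimately show ?thesis
      by simp
  qed
  then have "lin_ext ?\<psi> p \<in> W"
    unfolding q lin_ext_sum by (intro Wsum) auto
  moreover have "g \<in> W"
  proof -
    have "{P \<in> prods (set gs). lx P \<sqsubset> \<delta>} \<subseteq> {P \<in> prods G'. lx P \<sqsubset> \<delta>}"
      using prods_mono[OF G'(1)] by blast
    then have "g \<in> span_lt G' \<delta>"
      using p(2) lincomb_mono unfolding span_lt_def by blast
    then show ?thesis
      unfolding W_def using agree_refl by blast
  qed
  ultimately have "f \<in> W"
    unfolding p(3) by (rule Wadd)
  then obtain f' where "f' \<in> span_lt G' \<delta>" "agree ?\<Delta> f' f"
    unfolding W_def by blast
  then show thesis
    using that lexp_agree[OF f(2)] by blast
qed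

text \<open>This covers both a step of the process and, for \<open>hs = gs\<close>, a system all of whose remainders
  vanish. So one argument about infinite chains of such systems gives termination (a proper chain)
  and correctness (a constant chain).\<close>

definition reduces :: "('k :: field, 'n) mps list \<Rightarrow> ('k, 'n) mps list \<Rightarrow> bool" where
  "reduces gs hs \<longleftrightarrow> (\<exists>Ss Rs. admissible_choice prec a gs Ss Rs \<and>
     set gs \<union> {R \<in> set Rs. R \<noteq> 0} \<subseteq> set hs)"

text \<open>Each step along the chain lowers the bound of a representation and keeps the leading exponent
  \<open>e\<close>. Only finitely many exponents lie above \<open>e\<close>, so the bound becomes \<open>e\<close> itself; then one of the
  products has leading exponent \<open>e\<close>.\<close>

lemma span_le_reaches_lexp:
  fixes G :: "nat \<Rightarrow> ('k :: field, 'n) mps list"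
  assumes G: "\<And>k. 0 \<notin> set (G k)" "\<And>k. reduces (G k) (G (Suc k))"
  shows "f \<in> span_le (set (G k)) \<delta> \<Longrightarrow> f \<noteq> 0 \<Longrightarrow> lx f = e \<Longrightarrow>
    \<exists>j. e \<in> semigroup_gen (lx ` set (G j))"
proof (induction "card {\<gamma>. e \<sqsubseteq> \<gamma> \<and> \<gamma> \<sqsubseteq> \<delta>}" arbitrary: f k \<delta> rule: less_induct)
  case less
  have e: "e \<in> supp f" "e \<sqsubseteq> \<delta>"
    using lexp_greatest(1)[of f] supp_span_le[OF less.prems(1) G(1)] less.prems by auto
  show ?case
  proof (cases "e = \<delta>")
    case True
    obtain P where P: "P \<in> prods (set (G k))" "lx P \<sqsubseteq> \<delta>" "\<delta> \<in> supp P"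
      using supp_lincomb less.prems(1) e(1) unfolding span_le_def True by blast
    then have "\<delta> \<sqsubseteq> lx P"
      using supp_prods G(1) by blast
    then have "e = lx P"
      using P(2) True by simp
    then show ?thesis
      using semigroup_gen_eq_lexp_prods[OF G(1)] P(1) by blast
  next
    case False
    then have lt: "lx f \<sqsubset> \<delta>"
      using e(2) less.prems(3) by (simp add: ord.less_le)
    obtain Ss Rs where adm: "admissible_choice prec a (G k) Ss Rs"
      "set (G k) \<subseteq> set (G (Suc k))" "{R \<in> set Rs. R \<noteq> 0} \<subseteq> set (G (Suc k))"
      using G(2)[of k] unfolding reduces_def by blast
    obtain f' where f': "f' \<in> span_lt (set (G (Suc k))) \<delta>" "f' \<noteq> 0" "lx f' = lx f"
      by (rule reduction_step[OF G(1) adm less.prems(1,2) lt])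
    have "{\<beta>. \<beta> \<sqsubset> \<delta>} \<noteq> {}"
      using lt by blast
    from has_greatest[OF this]
    obtain \<delta>' where \<delta>': "\<delta>' \<sqsubset> \<delta>" "\<forall>\<beta>. \<beta> \<sqsubset> \<delta> \<longrightarrow> \<beta> \<sqsubseteq> \<delta>'"
      by auto
    have "f' \<in> span_le (set (G (Suc k))) \<delta>'"
      using f'(1) \<delta>'(2) lincomb_mono[of "{P \<in> prods (set (G (Suc k))). lx P \<sqsubset> \<delta>}"
        "{P \<in> prods (set (G (Suc k))). lx P \<sqsubseteq> \<delta>'}"]
      unfolding span_lt_def span_le_def by blast
    moreover have "card {\<gamma>. e \<sqsubseteq> \<gamma> \<and> \<gamma> \<sqsubseteq> \<delta>'} < card {\<gamma>. e \<sqsubseteq> \<gamma> \<and> \<gamma> \<sqsubseteq> \<delta>}"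
    proof (rule psubset_card_mono)
      show "finite {\<gamma>. e \<sqsubseteq> \<gamma> \<and> \<gamma> \<sqsubseteq> \<delta>}"
        by (rule finite_subset[OF _ finite_above[of e]]) blast
      have "\<gamma> \<sqsubseteq> \<delta>" if "\<gamma> \<sqsubseteq> \<delta>'" for \<gamma>
        using that \<delta>'(1) by auto
      moreover have "\<not> \<delta> \<sqsubseteq> \<delta>'"
        using \<delta>'(1) by auto
      ultimately show "{\<gamma>. e \<sqsubseteq> \<gamma> \<and> \<gamma> \<sqsubseteq> \<delta>'} \<subset> {\<gamma>. e \<sqsubseteq> \<gamma> \<and> \<gamma> \<sqsubseteq> \<delta>}"
        using e(2) by blast
    qed
    ultimately show ?thesis
      using less.hyps f'(2,3) less.prems(3) by simp
  qed
qed

lemma exp_set_covered: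
  fixes G :: "nat \<Rightarrow> ('k :: field, 'n) mps list"
  assumes "\<And>k. 0 \<notin> set (G k)" "\<And>k. reduces (G k) (G (Suc k))"
    and "e \<in> exp_set prec a (power_subalg (set (G 0)))"
  shows "\<exists>j. e \<in> semigroup_gen (lx ` set (G j))"
proof -
  obtain f where "f \<in> subalg (set (G 0))" "f \<noteq> 0" "lx f = e"
    using assms(3) unfolding exp_set_power_subalg by blast
  moreover from this(1) obtain \<delta> where "f \<in> span_le (set (G 0)) \<delta>"
    by (rule subalg_span_le)
  ultimately show ?thesis
    using span_le_reaches_lexp[of G, OF assms(1,2)] by blast
qed

end


section \<open>Finitely many homogeneous generators of the kernel\<close>

text \<open>Dickson's lemma. In the induction step a basis for the coordinates in \<open>I\<close> serves all elements
  whose new coordinate is at least the maximum \<open>N\<close> over that basis; each of the finitely many smaller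
  values of the new coordinate gets a basis of its own.\<close>

lemma dickson:
  fixes v :: "'x \<Rightarrow> 'i \<Rightarrow> nat"
  assumes "finite I"
  shows "\<exists>B \<subseteq> X. finite B \<and> (\<forall>x \<in> X. \<exists>b \<in> B. \<forall>i \<in> I. v b i \<le> v x i)"
  using assms
proof (induction I arbitrary: X)
  case empty
  show ?case
  proof (cases "X = {}")
    case False
    then obtain x where "x \<in> X"
      by blast
    then show ?thesis
      by (intro exI[of _ "{x}"]) auto
  qed auto
next
  case (insert j I)
  obtain B where B: "B \<subseteq> X" "finite B" "\<forall>x \<in> X. \<exists>b \<in> B. \<forall>i \<in> I. v b i \<le> v x i"
    using insert.IH[of X] by blast
  define N where "N = Max (insert 0 ((\<lambda>b. v b j) ` B))"
  have N: "v b j \<le> N" if "b \<in> B" for b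
    unfolding N_def using B(2) that by (intro Max_ge) auto
  have "\<forall>k. \<exists>C. C \<subseteq> {x \<in> X. v x j = k} \<and> finite C \<and>
      (\<forall>x \<in> {x \<in> X. v x j = k}. \<exists>b \<in> C. \<forall>i \<in> I. v b i \<le> v x i)"
    using insert.IH by blast
  from choice[OF this] obtain C where C: "\<And>k. C k \<subseteq> {x \<in> X. v x j = k} \<and> finite (C k) \<and>
      (\<forall>x \<in> {x \<in> X. v x j = k}. \<exists>b \<in> C k. \<forall>i \<in> I. v b i \<le> v x i)"
    by blast
  show ?case
  proof (intro exI[of _ "B \<union> (\<Union>k < N. C k)"] conjI ballI)
    show "B \<union> (\<Union>k < N. C k) \<subseteq> X"
      using B(1) C by blast
    show "finite (B \<union> (\<Union>k < N. C k))"
      using B(2) C by blast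
    fix x assume x: "x \<in> X"
    show "\<exists>b \<in> B \<union> (\<Union>k < N. C k). \<forall>i \<in> insert j I. v b i \<le> v x i"
    proof (cases "v x j < N")
      case True
      have "x \<in> {y \<in> X. v y j = v x j}"
        using x by simp
      then obtain b where "b \<in> C (v x j)" "\<forall>i \<in> I. v b i \<le> v x i"
        using C[of "v x j"] by blast
      moreover from this(1) have "v b j = v x j"
        using C[of "v x j"] by blast
      ultimately show ?thesis
        using True by (intro bexI[of _ b]) auto
    next
      case False
      obtain b where "b \<in> B" "\<forall>i \<in> I. v b i \<le> v x i"
        using B(3) x by blast
      then show ?thesis
        using False N[of b] by (intro bexI[of _ b]) auto
    qed
  qed
qed

lemma polys_add: "p \<in> polys s \<Longrightarrow> q \<in> polys s \<Longrightarrow> p + q \<in> polys s"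
  using Poly_Mapping.keys_add[of p q] by (auto simp: polys_def)

lemma polys_mult: "p \<in> polys s \<Longrightarrow> q \<in> polys s \<Longrightarrow> p * q \<in> polys s"
  using Poly_Mapping.keys_mult[of p q] by (fastforce simp: polys_def intro: expos_add)

lemma polys_sum: "(\<And>i. i \<in> I \<Longrightarrow> p i \<in> polys s) \<Longrightarrow> sum p I \<in> polys s"
  by (induction I rule: infinite_finite_induct) (auto intro: polys_add, simp_all add: polys_def)

lemma polys_single: "m \<in> expos s \<Longrightarrow> Poly_Mapping.single m c \<in> polys s"
  by (simp add: polys_def)

lemma poly_ideal_zero: "0 \<in> poly_ideal s Ss"
  unfolding poly_ideal_def by (auto intro!: exI[of _ "\<lambda>_. 0"] simp: polys_def)

lemma poly_ideal_add:
  assumes "p \<in> poly_ideal s Ss" "p' \<in> poly_ideal s Ss"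
  shows "p + p' \<in> poly_ideal s Ss"
proof -
  obtain q q' where "p = (\<Sum>i < length Ss. q i * Ss ! i)" "\<forall>i < length Ss. q i \<in> polys s"
    "p' = (\<Sum>i < length Ss. q' i * Ss ! i)" "\<forall>i < length Ss. q' i \<in> polys s"
    using assms unfolding poly_ideal_def by blast
  then show ?thesis
    unfolding poly_ideal_def
    by (intro CollectI exI[of _ "\<lambda>i. q i + q' i"])
      (simp add: distrib_right sum.distrib polys_add)
qed

lemma poly_ideal_mult:
  assumes "p \<in> poly_ideal s Ss" "r \<in> polys s"
  shows "r * p \<in> poly_ideal s Ss"
proof -
  obtain q where "p = (\<Sum>i < length Ss. q i * Ss ! i)" "\<forall>i < length Ss. q i \<in> polys s"
    using assms unfolding poly_ideal_def by blast
  then show ?thesis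
    unfolding poly_ideal_def using assms(2)
    by (intro CollectI exI[of _ "\<lambda>i. r * q i"])
      (simp add: sum_distrib_left mult.assoc polys_mult)
qed

lemma lin_ext_diff: "lin_ext \<phi> (p - q) = lin_ext \<phi> p - lin_ext \<phi> q"
  using lin_ext_add[of \<phi> "p - q" q] by simp

context weighted_order
begin

text \<open>The coefficient \<open>c\<close> in \<open>M(f\<^sup>m, a) = c x\<^sup>\<gamma>\<close>, where \<open>\<gamma>\<close> is the degree of \<open>m\<close>.\<close>

definition lead :: "('k :: field, 'n) mps list \<Rightarrow> (nat \<Rightarrow>\<^sub>0 nat) \<Rightarrow> 'k" where
  "lead gs m = mcoeff (power_prod gs m) (pdeg gs m)"

lemma lead_nonzero:
  assumes "0 \<notin> set gs"
  shows "lead gs m \<noteq> 0"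
  using lexp_greatest(1)[OF power_prod_lexp(1)[OF assms, of m]]
  unfolding power_prod_lexp(2)[OF assms] by (simp add: supp_def lead_def)

lemma lead_add:
  assumes "0 \<notin> set gs"
  shows "lead gs (m + l) = lead gs m * lead gs l"
  using lexp_mult(3)[OF power_prod_lexp(1)[OF assms, of m] power_prod_lexp(1)[OF assms, of l]]
  unfolding power_prod_lexp(2)[OF assms] lead_def pdeg_add power_prod_add .

definition kernel_binomial :: "('k :: field, 'n) mps list \<Rightarrow> (nat \<Rightarrow>\<^sub>0 nat) \<Rightarrow> (nat \<Rightarrow>\<^sub>0 nat) \<Rightarrow> 'k mpoly" where
  "kernel_binomial gs m l = Poly_Mapping.single m (lead gs l) - Poly_Mapping.single l (lead gs m)"

lemma kernel_binomial_add:
  assumes "0 \<notin> set gs"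
  shows "kernel_binomial gs (m + k) (l + j) =
    Poly_Mapping.single k (lead gs j) * kernel_binomial gs m l +
    Poly_Mapping.single l (lead gs m) * kernel_binomial gs k j"
  unfolding kernel_binomial_def lead_add[OF assms]
  by (simp add: right_diff_distrib mult_single ac_simps)

lemma mcoeff_peval_lmon:
  assumes "0 \<notin> set gs"
  shows "mcoeff (peval (map (lmon prec a) gs) p) \<gamma> =
    (\<Sum>m \<in> {m \<in> Poly_Mapping.keys p. pdeg gs m = \<gamma>}. Poly_Mapping.lookup p m * lead gs m)"
proof -
  have "mcoeff (peval (map (lmon prec a) gs) p) \<gamma> =
    (\<Sum>m \<in> Poly_Mapping.keys p. if pdeg gs m = \<gamma> then Poly_Mapping.lookup p m * lead gs m else 0)"
    unfolding mcoeff_peval mcoeff_lmon_power_prod[OF assms] by (intro sum.cong) (auto simp: lead_def)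
  then show ?thesis
    by (simp add: sum.inter_filter)
qed

lemma kernel_binomial_mem:
  assumes gs: "0 \<notin> set gs" and ml: "pdeg gs m = pdeg gs l" "m \<in> expos (length gs)" "l \<in> expos (length gs)"
  shows "kernel_binomial gs m l \<in> ker_phi prec a gs" "homogeneous prec a gs (kernel_binomial gs m l)"
proof -
  have k: "Poly_Mapping.keys (kernel_binomial gs m l) \<subseteq> {m, l}"
    using Poly_Mapping.keys_diff[of "Poly_Mapping.single m (lead gs l)" "Poly_Mapping.single l (lead gs m)"]
    by (auto simp: kernel_binomial_def split: if_splits)
  have "peval (map (lmon prec a) gs) (kernel_binomial gs m l) = 0"
    unfolding peval_eq_lin_ext kernel_binomial_def lin_ext_diff lin_ext_single
    by (rule mps_eqI) (simp add: mcoeff_lmon_power_prod[OF gs] ml(1), simp add: lead_def ml(1))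
  then show "kernel_binomial gs m l \<in> ker_phi prec a gs"
    using k ml(2,3) by (auto simp: ker_phi_def polys_def)
  show "homogeneous prec a gs (kernel_binomial gs m l)"
    unfolding homogeneous_def using k ml(1) by (intro exI[of _ "pdeg gs m"]) auto
qed

text \<open>The pairs of exponents of equal degree form a monoid that contains the difference of any two
  comparable elements, so it is generated by a Dickson basis of its nonzero elements. As the binomial
  of a sum of pairs is a combination of the two binomials, the corresponding finitely many binomials
  generate all binomials, and these generate the kernel.\<close>

lemma kernel_generators_exist:
  fixes gs :: "('k :: field, 'n) mps list"
  assumes gs: "0 \<notin> set gs"
  shows "\<exists>Ss. ker_generators prec a gs Ss \<and> (\<forall>S \<in> set Ss. homogeneous prec a gs S)"
proof -
  let ?s = "length gs"
  define L where "L = {(m, l). m \<in> expos ?s \<and> l \<in> expos ?s \<and> pdeg gs m = pdeg gs l}"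
  define v where "v = (\<lambda>(m, l). case_sum (Poly_Mapping.lookup m) (Poly_Mapping.lookup l) :: nat + nat \<Rightarrow> nat)"
  have "finite ({..<?s} <+> {..<?s})"
    by simp
  from dickson[OF this, of "L - {(0, 0)}" v]
  obtain B where B: "B \<subseteq> L - {(0, 0)}" "finite B"
    "\<forall>x \<in> L - {(0, 0)}. \<exists>b \<in> B. \<forall>i \<in> {..<?s} <+> {..<?s}. v b i \<le> v x i"
    by blast
  obtain bs where bs: "set bs = B"
    using finite_list[OF B(2)] by blast
  define Ss where "Ss = map (\<lambda>(m, l). kernel_binomial gs m l) bs"
  have Ss: "S \<in> ker_phi prec a gs" "homogeneous prec a gs S" if "S \<in> set Ss" for S
    using that kernel_binomial_mem[OF gs] B(1) by (auto simp: Ss_def bs L_def)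
  have gen: "S \<in> poly_ideal ?s Ss" if "S \<in> set Ss" for S
    using that poly_ideal_gen by (metis in_set_conv_nth)
  have binom: "kernel_binomial gs m l \<in> poly_ideal ?s Ss" if "(m, l) \<in> L" for m l
    using that
  proof (induction "\<Sum>i < ?s. Poly_Mapping.lookup m i + Poly_Mapping.lookup l i" arbitrary: m l
      rule: less_induct)
    case less
    show ?case
    proof (cases "(m, l) = (0, 0)")
      case True
      then show ?thesis
        by (simp add: kernel_binomial_def poly_ideal_zero)
    next
      case False
      then obtain n k where b: "(n, k) \<in> B"
        and le: "\<forall>i \<in> {..<?s} <+> {..<?s}. v (n, k) i \<le> v (m, l) i"
        using B(3) less.prems by fast
      have nk: "(n, k) \<in> L" "(n, k) \<noteq> (0, 0)"
        using b B(1) by auto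
      have zero: "Poly_Mapping.lookup x i = 0" if "x \<in> expos ?s" "\<not> i < ?s" for x i
        using that by (auto simp: expos_def in_keys_iff subset_iff)
      have le': "Poly_Mapping.lookup n i \<le> Poly_Mapping.lookup m i"
        "Poly_Mapping.lookup k i \<le> Poly_Mapping.lookup l i" for i
      proof -
        have "Poly_Mapping.lookup n i \<le> Poly_Mapping.lookup m i \<and>
          Poly_Mapping.lookup k i \<le> Poly_Mapping.lookup l i"
        proof (cases "i < ?s")
          case True
          then show ?thesis
            using le[rule_format, of "Inl i"] le[rule_format, of "Inr i"] by (auto simp: v_def)
        next
          case False
          then show ?thesis
            using nk(1) zero[of n i] zero[of k i] by (auto simp: L_def)
        qed
        then show "Poly_Mapping.lookup n i \<le> Poly_Mapping.lookup m i"
          "Poly_Mapping.lookup k i \<le> Poly_Mapping.lookup l i"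
          by auto
      qed
      have split: "m = n + (m - n)" "l = k + (l - k)"
        by (rule poly_mapping_eqI; simp add: lookup_add lookup_minus le')+
      have "m - n \<in> expos ?s" "l - k \<in> expos ?s"
        using less.prems by (auto simp: L_def expos_def in_keys_iff lookup_minus subset_iff)
      moreover have "pdeg gs (m - n) = pdeg gs (l - k)"
      proof -
        have "pdeg gs n + pdeg gs (m - n) = pdeg gs k + pdeg gs (l - k)"
          using less.prems unfolding pdeg_add[symmetric] split[symmetric] by (simp add: L_def)
        then show ?thesis
          using nk(1) by (simp add: L_def)
      qed
      ultimately have diff: "(m - n, l - k) \<in> L"
        by (simp add: L_def)
      have "n \<noteq> 0 \<or> k \<noteq> 0"
        using nk(2) by auto
      then obtain i where "Poly_Mapping.lookup n i \<noteq> 0 \<or> Poly_Mapping.lookup k i \<noteq> 0"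
        by (metis lookup_zero poly_mapping_eqI)
      moreover from this have "i < ?s"
        using zero[of n i] zero[of k i] nk(1) by (cases "i < ?s") (auto simp: L_def)
      ultimately have "(\<Sum>i < ?s. Poly_Mapping.lookup (m - n) i + Poly_Mapping.lookup (l - k) i) <
          (\<Sum>i < ?s. Poly_Mapping.lookup m i + Poly_Mapping.lookup l i)"
        using le'[of i] by (intro sum_strict_mono_ex1) (auto simp: lookup_minus intro!: add_mono bexI[of _ i])
      then have "kernel_binomial gs (m - n) (l - k) \<in> poly_ideal ?s Ss"
        using less.hyps diff by blast
      moreover have "kernel_binomial gs n k \<in> poly_ideal ?s Ss"
        by (rule gen) (use b in \<open>force simp: Ss_def bs\<close>)
      ultimately have "kernel_binomial gs (n + (m - n)) (k + (l - k)) \<in> poly_ideal ?s Ss"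
        unfolding kernel_binomial_add[OF gs]
        using \<open>m - n \<in> expos ?s\<close> nk(1)
        by (intro poly_ideal_add poly_ideal_mult polys_single) (auto simp: L_def)
      then show ?thesis
        unfolding split[symmetric] .
    qed
  qed
  have "poly_ideal ?s Ss \<subseteq> ker_phi prec a gs"
  proof
    fix p assume "p \<in> poly_ideal ?s Ss"
    then obtain q where q: "p = (\<Sum>i < length Ss. q i * Ss ! i)" "\<forall>i < length Ss. q i \<in> polys ?s"
      unfolding poly_ideal_def by blast
    have "Ss ! i \<in> polys ?s" "peval (map (lmon prec a) gs) (Ss ! i) = 0" if "i < length Ss" for i
      using Ss(1)[of "Ss ! i"] that by (auto simp: ker_phi_def)
    moreover from this have "peval (map (lmon prec a) gs) p = 0"
      unfolding q(1) peval_eq_lin_ext lin_ext_sum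
      unfolding peval_eq_lin_ext[symmetric] peval_mult by simp
    ultimately show "p \<in> ker_phi prec a gs"
      using q by (auto simp: ker_phi_def intro!: polys_sum polys_mult)
  qed
  moreover have "p \<in> poly_ideal ?s Ss" if "p \<in> ker_phi prec a gs" for p
    using that
  proof (induction "card (Poly_Mapping.keys p)" arbitrary: p rule: less_induct)
    case less
    show ?case
    proof (cases "p = 0")
      case True
      then show ?thesis
        by (simp add: poly_ideal_zero)
    next
      case False
      then obtain m where m: "m \<in> Poly_Mapping.keys p"
        by fastforce
      define T where "T = {l \<in> Poly_Mapping.keys p. pdeg gs l = pdeg gs m}"
      have "T \<noteq> {m}"
      proof
        assume "T = {m}"
        moreover have "(\<Sum>l \<in> T. Poly_Mapping.lookup p l * lead gs l) = 0"
          using less.prems mcoeff_peval_lmon[OF gs, of p "pdeg gs m"] by (simp add: ker_phi_def T_def)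
        ultimately show False
          using m lead_nonzero[OF gs, of m] by (simp add: in_keys_iff)
      qed
      moreover have "m \<in> T"
        using m by (simp add: T_def)
      ultimately obtain l where l: "l \<noteq> m" "l \<in> Poly_Mapping.keys p" "pdeg gs m = pdeg gs l"
        unfolding T_def by force
      have expos: "m \<in> expos ?s" "l \<in> expos ?s"
        using less.prems m l(2) by (auto simp: ker_phi_def polys_def)
      \<comment> \<open>The multiple of the binomial of \<open>m\<close> and \<open>l\<close> whose subtraction removes \<open>m\<close> from \<open>p\<close> and introduces
        no new monomial.\<close>
      define r where "r = Poly_Mapping.lookup p m / lead gs l"
      define b where "b = Poly_Mapping.single 0 r * kernel_binomial gs m l"
      have b: "b = Poly_Mapping.single m (Poly_Mapping.lookup p m) - Poly_Mapping.single l (r * lead gs m)"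
        using lead_nonzero[OF gs, of l] by (simp add: b_def kernel_binomial_def right_diff_distrib mult_single r_def)
      have ideal: "b \<in> poly_ideal ?s Ss"
        unfolding b_def using expos l(3)
        by (intro poly_ideal_mult polys_single expos_0 binom) (simp add: L_def)
      then have ker: "b \<in> ker_phi prec a gs"
        using \<open>poly_ideal ?s Ss \<subseteq> ker_phi prec a gs\<close> by blast
      have keys: "Poly_Mapping.keys (p - b) \<subseteq> Poly_Mapping.keys p - {m}"
        using l m by (auto simp: b in_keys_iff lookup_minus lookup_single when_def split: if_splits)
      then have "p - b \<in> ker_phi prec a gs"
        using less.prems ker by (auto simp: ker_phi_def polys_def peval_eq_lin_ext lin_ext_diff)
      moreover have "card (Poly_Mapping.keys (p - b)) < card (Poly_Mapping.keys p)"
        using keys m by (intro psubset_card_mono) auto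
      ultimately have "p - b \<in> poly_ideal ?s Ss"
        using less.hyps by blast
      from poly_ideal_add[OF this ideal] show ?thesis
        by simp
    qed
  qed
  ultimately have "poly_ideal ?s Ss = ker_phi prec a gs"
    by blast
  then show ?thesis
    unfolding ker_generators_def using Ss by (intro exI[of _ Ss]) (auto simp: ker_phi_def)
qed

end


section \<open>Existence of remainders\<close>

lemma finite_low_degree: "finite (low_degree N :: (nat ^ 'n :: finite) set)"
proof -
  have "low_degree N \<subseteq> {\<alpha> :: nat ^ 'n. \<forall>i. \<alpha> $ i \<le> (\<chi> i. N) $ i}"
  proof safe
    fix \<alpha> :: "nat ^ 'n" and i assume "(\<Sum>i \<in> UNIV. \<alpha> $ i) < N"
    moreover have "\<alpha> $ i \<le> (\<Sum>i \<in> UNIV. \<alpha> $ i)"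
      by (rule member_le_sum) auto
    ultimately show "\<alpha> $ i \<le> (\<chi> i. N) $ i"
      by simp
  qed
  then show ?thesis
    using finite_below_vec by (rule finite_subset)
qed

context weighted_order
begin

lemma max_wrt_pair:
  assumes "\<alpha> \<sqsubset> \<beta>"
  shows "max_wrt lt {\<alpha>, \<beta>} = \<beta>" "max_wrt lt {\<beta>, \<alpha>} = \<beta>"
proof -
  show "max_wrt lt {\<alpha>, \<beta>} = \<beta>"
    unfolding max_wrt_def by (rule the_equality) (use assms ord.less_asym in auto)
  then show "max_wrt lt {\<beta>, \<alpha>} = \<beta>"
    by (simp add: insert_commute)
qed

text \<open>The system is triangular because the \<open>\<gamma>\<close>-th unknown has a nonzero coefficient in the \<open>\<gamma>\<close>-th
  equation, which otherwise involves only the finitely many unknowns with a larger index.\<close>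

lemma triangular_system:
  fixes F :: "nat ^ 'n \<Rightarrow> 'k :: field" and P :: "nat ^ 'n \<Rightarrow> nat ^ 'n \<Rightarrow> 'k"
  assumes P: "\<And>\<gamma>. \<gamma> \<in> S \<Longrightarrow> P \<gamma> \<gamma> \<noteq> 0"
  shows "\<exists>d. (\<forall>\<gamma>. \<gamma> \<notin> S \<longrightarrow> d \<gamma> = 0) \<and>
    (\<forall>\<gamma> \<in> S. d \<gamma> * P \<gamma> \<gamma> = F \<gamma> - (\<Sum>\<gamma>' \<in> {\<gamma>' \<in> S. \<gamma> \<sqsubset> \<gamma>'}. d \<gamma>' * P \<gamma>' \<gamma>))"
proof -
  define r where "r = {(\<gamma>', \<gamma>). \<gamma> \<sqsubset> \<gamma>'}"
  define \<Phi> where "\<Phi> d \<gamma> = (if \<gamma> \<in> S then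
    (F \<gamma> - (\<Sum>\<gamma>' \<in> {\<gamma>' \<in> S. \<gamma> \<sqsubset> \<gamma>'}. d \<gamma>' * P \<gamma>' \<gamma>)) / P \<gamma> \<gamma> else 0)" for d \<gamma>
  have wf: "wf r"
    using wfp_gt unfolding r_def wfp_def .
  define d where "d = wfrec r \<Phi>"
  have "d \<gamma> = \<Phi> d \<gamma>" for \<gamma>
  proof -
    have "d \<gamma> = \<Phi> (cut d r \<gamma>) \<gamma>"
      unfolding d_def by (rule wfrec[OF wf])
    also have "\<dots> = \<Phi> d \<gamma>"
      by (simp add: \<Phi>_def cut_def r_def)
    finally show ?thesis .
  qed
  then show ?thesis
    by (intro exI[of _ d]) (metis (no_types, lifting) P \<Phi>_def nonzero_eq_divide_eq)
qed

text \<open>Division in one step instead of by iteration: each \<open>\<gamma>\<close> in the semigroup is the leading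
  exponent of a chosen product \<open>P \<gamma>\<close>, and the coefficients \<open>d \<gamma>\<close> solve the triangular system which
  says that \<open>\<Sum>\<^sub>\<gamma> d \<gamma> P \<gamma>\<close> agrees with \<open>F\<close> on the semigroup.\<close>

lemma remainder_exists:
  fixes F :: "('k :: field, 'n) mps"
  assumes gs: "0 \<notin> set gs"
  shows "\<exists>R. is_remainder prec a F gs R"
proof (cases "F = 0")
  case True
  then show ?thesis
    by (simp add: is_remainder_def)
next
  case False
  let ?E = "expos (length gs)"
  define e where "e = lx F"
  have F: "e \<in> supp F" "supp F \<subseteq> down e"
    unfolding e_def by (rule lexp_greatest[OF False])+
  define S where "S = pdeg gs ` ?E"
  have S: "semigroup_gen (lx ` set gs) = S"
    unfolding semigroup_gen_eq_lexp_prods[OF gs] S_def prods_set_eq image_image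
    by (simp add: power_prod_lexp(2)[OF gs])
  define \<mu> where "\<mu> \<gamma> = (SOME m. m \<in> ?E \<and> pdeg gs m = \<gamma>)" for \<gamma>
  have \<mu>: "\<mu> \<gamma> \<in> ?E" "pdeg gs (\<mu> \<gamma>) = \<gamma>" if "\<gamma> \<in> S" for \<gamma>
    using that someI_ex[of "\<lambda>m. m \<in> ?E \<and> pdeg gs m = \<gamma>"] unfolding \<mu>_def S_def by auto
  define P where "P \<gamma> = power_prod gs (\<mu> \<gamma>)" for \<gamma>
  have P: "supp (P \<gamma>) \<subseteq> down \<gamma>" "mcoeff (P \<gamma>) \<gamma> \<noteq> 0" if "\<gamma> \<in> S" for \<gamma>
    using supp_power_prod[OF gs, of "\<mu> \<gamma>"] lead_nonzero[OF gs, of "\<mu> \<gamma>"] \<mu>(2)[OF that]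
    by (simp_all add: P_def lead_def)
  obtain d where d0: "\<And>\<gamma>. \<gamma> \<notin> S \<Longrightarrow> d \<gamma> = 0" and
    d: "\<And>\<gamma>. \<gamma> \<in> S \<Longrightarrow> d \<gamma> * mcoeff (P \<gamma>) \<gamma> =
      mcoeff F \<gamma> - (\<Sum>\<gamma>' \<in> {\<gamma>' \<in> S. \<gamma> \<sqsubset> \<gamma>'}. d \<gamma>' * mcoeff (P \<gamma>') \<gamma>)"
    using triangular_system[of S "\<lambda>\<gamma>. mcoeff (P \<gamma>)" "mcoeff F"] P(2) by blast
  have above: "d \<gamma> = 0" if "\<not> \<gamma> \<sqsubseteq> e" for \<gamma>
    using that
  proof (induction \<gamma> rule: wfp_induct_rule[OF wfp_gt])
    case (1 \<gamma>)
    show ?case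
    proof (cases "\<gamma> \<in> S")
      case True
      have "d \<gamma>' = 0" if "\<gamma> \<sqsubset> \<gamma>'" for \<gamma>'
        using that 1 by (meson ord.less_le_trans ord.not_le ord.less_imp_le ord.order.trans)
      moreover have "mcoeff F \<gamma> = 0"
        using F(2) 1(2) by (auto simp: supp_def)
      ultimately have "d \<gamma> * mcoeff (P \<gamma>) \<gamma> = 0"
        unfolding d[OF True] by simp
      then show ?thesis
        using P(2)[OF True] by simp
    qed (rule d0)
  qed
  define H where "H = Mps (\<lambda>\<beta>. \<Sum>\<gamma> \<in> {\<gamma> \<in> S. \<beta> \<sqsubseteq> \<gamma>}. d \<gamma> * mcoeff (P \<gamma>) \<beta>)"
  have fin: "finite {\<gamma> \<in> S. \<beta> \<sqsubseteq> \<gamma>}" for \<beta>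
    by (rule finite_subset[OF _ finite_above[of \<beta>]]) blast
  have HS: "mcoeff H \<gamma> = mcoeff F \<gamma>" if "\<gamma> \<in> S" for \<gamma>
  proof -
    have "{\<gamma>' \<in> S. \<gamma> \<sqsubseteq> \<gamma>'} = insert \<gamma> {\<gamma>' \<in> S. \<gamma> \<sqsubset> \<gamma>'}"
      using that by (auto simp: ord.le_less)
    moreover have "finite {\<gamma>' \<in> S. \<gamma> \<sqsubset> \<gamma>'}"
      by (rule finite_subset[OF _ fin[of \<gamma>]]) auto
    ultimately show ?thesis
      using d[OF that] by (simp add: H_def)
  qed
  have Hterm: "\<exists>\<gamma> \<in> S. d \<gamma> \<noteq> 0 \<and> \<beta> \<sqsubseteq> \<gamma> \<and> \<gamma> \<sqsubseteq> e" if "\<beta> \<in> supp H" for \<beta>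
  proof -
    have "(\<Sum>\<gamma> \<in> {\<gamma> \<in> S. \<beta> \<sqsubseteq> \<gamma>}. d \<gamma> * mcoeff (P \<gamma>) \<beta>) \<noteq> 0"
      using that by (simp add: supp_def H_def)
    then obtain \<gamma> where "\<gamma> \<in> {\<gamma> \<in> S. \<beta> \<sqsubseteq> \<gamma>}" "d \<gamma> * mcoeff (P \<gamma>) \<beta> \<noteq> 0"
      by (rule sum.not_neutral_contains_not_neutral)
    then show ?thesis
      using above[of \<gamma>] by auto
  qed
  have Hdown: "supp H \<subseteq> down e"
    using Hterm ord.order.trans by blast
  have He: "e \<in> S" "d e \<noteq> 0" if eH: "e \<in> supp H"
  proof -
    obtain \<gamma> where "\<gamma> \<in> S" "d \<gamma> \<noteq> 0" "e \<sqsubseteq> \<gamma>" "\<gamma> \<sqsubseteq> e"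
      using Hterm[OF eH] by blast
    then show "e \<in> S" "d e \<noteq> 0"
      using ord.order.antisym by blast+
  qed
  define R where "R = F - H"
  have R: "supp R \<inter> S = {}" "supp R \<subseteq> down e"
  proof -
    show "supp R \<inter> S = {}"
      using HS by (auto simp: R_def supp_def)
    have "supp R \<subseteq> supp F \<union> supp H"
      by (auto simp: R_def supp_def)
    then show "supp R \<subseteq> down e"
      using F(2) Hdown by (meson Un_least order.trans)
  qed
  define c where "c m = (if pdeg gs m \<in> S \<and> \<mu> (pdeg gs m) = m then d (pdeg gs m) else 0)" for m
  have c\<mu>: "c (\<mu> \<gamma>) = d \<gamma>" if "\<gamma> \<in> S" for \<gamma>
    using \<mu>[OF that] that by (simp add: c_def)
  have cD: "pdeg gs m \<in> S" "\<mu> (pdeg gs m) = m" "d (pdeg gs m) \<noteq> 0" if "c m \<noteq> 0" for m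
    using that by (auto simp: c_def split: if_splits)
  have sum: "((\<lambda>m. mps_const (c m) * power_prod gs m) has_sum H) ?E"
    unfolding has_sum_mps_iff
  proof
    fix N
    define X where "X = \<mu> ` (\<Union>\<beta> \<in> low_degree N. {\<gamma> \<in> S. \<beta> \<sqsubseteq> \<gamma>})"
    have "agree (low_degree N) (\<Sum>m \<in> Y. mps_const (c m) * power_prod gs m) H"
      if Y: "finite Y" "X \<subseteq> Y" "Y \<subseteq> ?E" for Y
      unfolding agree_def
    proof
      fix \<beta> :: "nat ^ 'n" assume \<beta>: "\<beta> \<in> low_degree N"
      let ?T = "{\<gamma> \<in> S. \<beta> \<sqsubseteq> \<gamma>}"
      have "mcoeff (\<Sum>m \<in> Y. mps_const (c m) * power_prod gs m) \<beta> =
          (\<Sum>m \<in> Y. c m * mcoeff (power_prod gs m) \<beta>)"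
        by (simp add: mcoeff_sum)
      also have "\<dots> = (\<Sum>m \<in> \<mu> ` ?T. c m * mcoeff (power_prod gs m) \<beta>)"
      proof (rule sum.mono_neutral_right[OF Y(1)])
        show "\<mu> ` ?T \<subseteq> Y"
          using \<beta> Y(2) unfolding X_def by blast
        show "\<forall>m \<in> Y - \<mu> ` ?T. c m * mcoeff (power_prod gs m) \<beta> = 0"
        proof (intro ballI, rule ccontr)
          fix m assume m: "m \<in> Y - \<mu> ` ?T" "c m * mcoeff (power_prod gs m) \<beta> \<noteq> 0"
          then have "\<beta> \<sqsubseteq> pdeg gs m"
            using supp_power_prod[OF gs, of m] by (auto simp: supp_def)
          then have "\<mu> (pdeg gs m) \<in> \<mu> ` ?T"
            using cD(1)[of m] m(2) by auto
          then show False
            using cD(2)[of m] m by auto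
        qed
      qed
      also have "\<dots> = (\<Sum>\<gamma> \<in> ?T. c (\<mu> \<gamma>) * mcoeff (power_prod gs (\<mu> \<gamma>)) \<beta>)"
        by (subst sum.reindex) (auto intro!: inj_onI dest: arg_cong[of "\<mu> _" _ "pdeg gs"] simp: \<mu>(2))
      also have "\<dots> = mcoeff H \<beta>"
        by (simp add: H_def c\<mu> P_def)
      finally show "mcoeff (\<Sum>m \<in> Y. mps_const (c m) * power_prod gs m) \<beta> = mcoeff H \<beta>" .
    qed
    moreover have "finite X"
      unfolding X_def by (intro finite_imageI finite_UN_I finite_low_degree fin)
    moreover have "X \<subseteq> ?E"
      using \<mu>(1) unfolding X_def by blast
    ultimately show "\<exists>X. finite X \<and> X \<subseteq> ?E \<and> (\<forall>Y. finite Y \<longrightarrow> X \<subseteq> Y \<longrightarrow> Y \<subseteq> ?E \<longrightarrow>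
        agree (low_degree N) (\<Sum>m \<in> Y. mps_const (c m) * power_prod gs m) H)"
      by blast
  qed
  have Hmem: "H \<in> power_subalg (set gs)"
    by (rule has_sum_mem_power_subalg[OF sum])
      (use power_prod_mem_prods prods_subset_subalg in \<open>blast intro: subalg.mult subalg.const\<close>)
  have max: "lx F = max_wrt lt {lx H, lx R}" if nz: "H \<noteq> 0" "R \<noteq> 0"
  proof -
    have lxR: "lx R \<in> supp R" "lx R \<sqsubseteq> e" and lxH: "lx H \<in> supp H" "lx H \<sqsubseteq> e"
      using lexp_greatest(1)[OF nz(2)] lexp_greatest(1)[OF nz(1)] R(2) Hdown by auto
    show ?thesis
    proof (cases "e \<in> S")
      case True
      have "lx H = e"
        by (rule lexp_eqI) (use HS[OF True] F(1) Hdown in \<open>auto simp: supp_def\<close>)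
      moreover have "lx R \<sqsubset> e"
        using lxR R(1) True ord.le_less by blast
      ultimately show ?thesis
        by (simp add: max_wrt_pair e_def)
    next
      case False
      then have "e \<notin> supp H"
        using He(1) by blast
      then have "lx H \<sqsubset> e" "e \<in> supp R"
        using lxH F(1) ord.le_less by (blast, simp add: R_def supp_def)
      moreover from this(2) have "lx R = e"
        using R(2) by (rule lexp_eqI)
      ultimately show ?thesis
        by (simp add: max_wrt_pair e_def)
    qed
  qed
  have bound: "lx (power_prod gs m) \<sqsubseteq> lx F" if "c m \<noteq> 0" for m
    using above cD(3)[OF that] unfolding power_prod_lexp(2)[OF gs] e_def by blast
  have uniq: "\<exists>!m. m \<in> ?E \<and> c m \<noteq> 0 \<and> lx F = lx (power_prod gs m)" if "R = 0"
  proof -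
    have "e \<in> supp H"
      using that F(1) by (simp add: R_def)
    from He[OF this] have e: "e \<in> S" "d e \<noteq> 0" .
    show ?thesis
      unfolding power_prod_lexp(2)[OF gs] e_def[symmetric]
    proof (rule ex1I[of _ "\<mu> e"])
      show "\<mu> e \<in> ?E \<and> c (\<mu> e) \<noteq> 0 \<and> e = pdeg gs (\<mu> e)"
        using e \<mu>[OF e(1)] c\<mu>[OF e(1)] by simp
      show "m = \<mu> e" if "m \<in> ?E \<and> c m \<noteq> 0 \<and> e = pdeg gs m" for m
        using that cD(2)[of m] by simp
    qed
  qed
  have "is_remainder prec a F gs R"
    unfolding is_remainder_def S
    using False Hmem max bound uniq sum R by (auto simp: R_def e_def intro!: bexI[of _ H] exI[of _ c])
  then show ?thesis
    by blast
qed


section \<open>The completion process\<close>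

lemma remainder_mem_power_subalg:
  assumes "is_remainder prec a F gs R" "F \<in> power_subalg (set gs)"
  shows "R \<in> power_subalg (set gs)"
proof (cases "F = 0")
  case True
  then show ?thesis
    using assms by (simp add: is_remainder_def)
next
  case False
  then obtain H where "H \<in> power_subalg (set gs)" "F = H + R"
    using assms(1) unfolding is_remainder_def by auto
  then show ?thesis
    using power_subalg_minus[OF assms(2)] by fastforce
qed

lemma remainder_lexp_new:
  assumes "is_remainder prec a F gs R" "R \<noteq> 0"
  shows "lx R \<notin> semigroup_gen (lx ` set gs)"
  using assms lexp_greatest(1)[OF assms(2)] unfolding is_remainder_def by (auto split: if_splits)

lemma semigroup_gen_mono: "E \<subseteq> E' \<Longrightarrow> semigroup_gen E \<subseteq> semigroup_gen E'"
proof
  fix \<alpha> assume "E \<subseteq> E'" "\<alpha> \<in> semigroup_gen E"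
  from this(2,1) show "\<alpha> \<in> semigroup_gen E'"
    by induction (auto intro: semigroup_gen.intros)
qed

lemma semigroup_gen_least: "E \<subseteq> semigroup_gen E' \<Longrightarrow> semigroup_gen E \<subseteq> semigroup_gen E'"
proof
  fix \<alpha> assume "E \<subseteq> semigroup_gen E'" "\<alpha> \<in> semigroup_gen E"
  from this(2,1) show "\<alpha> \<in> semigroup_gen E'"
    by induction (auto intro: semigroup_gen.intros)
qed

lemma subset_power_subalg: "S \<subseteq> power_subalg S"
  using subalg.gen subalg_subset_power_subalg by blast

lemma extended_by_set:
  assumes "extended_by fs Rs gs"
  shows "set gs = set fs \<union> {R \<in> set Rs. R \<noteq> 0}"
  using assms unfolding extended_by_def by (metis set_append)

lemma extended_by_enlarges_semigroup:
  fixes fs :: "('k :: field, 'n) mps list"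
  assumes fs: "0 \<notin> set fs" and R: "remainders prec a fs Ss Rs" "\<exists>R \<in> set Rs. R \<noteq> 0"
    and gs: "extended_by fs Rs gs"
  shows "0 \<notin> set gs" "power_subalg (set gs) = power_subalg (set fs)"
    "semigroup_gen (lx ` set fs) \<subset> semigroup_gen (lx ` set gs)"
    "semigroup_gen (lx ` set gs) \<subseteq> exp_set prec a (power_subalg (set fs))"
proof -
  note set = extended_by_set[OF gs]
  then show 0: "0 \<notin> set gs"
    using fs by auto
  have rem: "\<exists>F. is_remainder prec a F fs R \<and> F \<in> power_subalg (set fs)" if "R \<in> set Rs" for R
  proof -
    obtain i where "i < length Rs" "R = Rs ! i"
      using \<open>R \<in> set Rs\<close> by (auto simp: in_set_conv_nth)
    then have "is_remainder prec a (peval fs (Ss ! i)) fs R"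
      using R(1) unfolding remainders_def by simp
    then show ?thesis
      using peval_mem_subalg subalg_subset_power_subalg by blast
  qed
  have sub: "set gs \<subseteq> power_subalg (set fs)"
    using rem remainder_mem_power_subalg subset_power_subalg unfolding set by blast
  then show "power_subalg (set gs) = power_subalg (set fs)"
    using power_subalg_least[OF sub] power_subalg_least[of "set fs" "set gs"]
      subset_power_subalg[of "set gs"] unfolding set by blast
  show "semigroup_gen (lx ` set gs) \<subseteq> exp_set prec a (power_subalg (set fs))"
    using 0 sub by (rule semigroup_gen_subset_exp_set)
  obtain R0 where R0: "R0 \<in> set Rs" "R0 \<noteq> 0"
    using R(2) by blast
  then have "lx R0 \<in> semigroup_gen (lx ` set gs)" "lx R0 \<notin> semigroup_gen (lx ` set fs)"
    using rem remainder_lexp_new unfolding set by (auto intro: semigroup_gen.gen)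
  moreover have "semigroup_gen (lx ` set fs) \<subseteq> semigroup_gen (lx ` set gs)"
    by (rule semigroup_gen_mono) (auto simp: set)
  ultimately show "semigroup_gen (lx ` set fs) \<subset> semigroup_gen (lx ` set gs)"
    by blast
qed

lemma process_step_extension:
  fixes fs :: "('k :: field, 'n) mps list"
  assumes fs: "0 \<notin> set fs" and "process_step prec a fs gs"
  shows "0 \<notin> set gs" "power_subalg (set gs) = power_subalg (set fs)" "reduces fs gs"
    "semigroup_gen (lx ` set fs) \<subset> semigroup_gen (lx ` set gs)"
    "semigroup_gen (lx ` set gs) \<subseteq> exp_set prec a (power_subalg (set fs))"
proof -
  obtain Ss Rs where *: "admissible_choice prec a fs Ss Rs" "\<exists>R \<in> set Rs. R \<noteq> 0" "extended_by fs Rs gs"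
    using assms(2) unfolding process_step_def by blast
  then have "remainders prec a fs Ss Rs"
    by (simp add: admissible_choice_def)
  note ext = extended_by_enlarges_semigroup[OF fs this *(2,3)]
  show "0 \<notin> set gs" "power_subalg (set gs) = power_subalg (set fs)"
    "semigroup_gen (lx ` set fs) \<subset> semigroup_gen (lx ` set gs)"
    "semigroup_gen (lx ` set gs) \<subseteq> exp_set prec a (power_subalg (set fs))"
    by (rule ext)+
  show "reduces fs gs"
    unfolding reduces_def using *(1) extended_by_set[OF *(3)] by blast
qed

text \<open>A system without nonzero remainders reduces to itself, so the constant chain is covered by its
  own semigroup.\<close>

lemma canonical_basisI:
  fixes fs :: "('k :: field, 'n) mps list"
  assumes fs: "0 \<notin> set fs" and "admissible_choice prec a fs Ss Rs" "\<forall>R \<in> set Rs. R = 0"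
  shows "canonical_basis prec a (power_subalg (set fs)) (set fs)"
proof -
  have "reduces fs fs"
    unfolding reduces_def using assms(2,3) by blast
  then have "exp_set prec a (power_subalg (set fs)) \<subseteq> semigroup_gen (lx ` set fs)"
    using exp_set_covered[of "\<lambda>_. fs"] fs by blast
  then show ?thesis
    using fs semigroup_gen_subset_exp_set[OF fs subset_power_subalg] subset_power_subalg
    unfolding canonical_basis_def by blast
qed

lemma process_continues:
  fixes gs :: "('k :: field, 'n) mps list"
  assumes gs: "0 \<notin> set gs"
  shows "process_stops prec a gs \<or> (\<exists>hs. process_step prec a gs hs)"
proof -
  obtain Ss where Ss: "ker_generators prec a gs Ss" "\<forall>S \<in> set Ss. homogeneous prec a gs S"
    using kernel_generators_exist[OF gs] by blast
  define Rs where "Rs = map (\<lambda>S. SOME R. is_remainder prec a (peval gs S) gs R) Ss"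
  have "remainders prec a gs Ss Rs"
    unfolding remainders_def Rs_def using someI_ex[OF remainder_exists[OF gs]] by simp
  then have adm: "admissible_choice prec a gs Ss Rs"
    using Ss by (simp add: admissible_choice_def)
  have "extended_by gs Rs (gs @ filter (\<lambda>R. R \<noteq> 0) Rs)"
    unfolding extended_by_def by auto
  then show ?thesis
    using adm unfolding process_stops_def process_step_def by blast
qed

text \<open>An increasing chain of subsemigroups of \<open>\<nat>\<^sup>n\<close> need not become stationary. Here the chain
  exhausts \<open>exp(A, a)\<close>, so the finite set \<open>E\<close> lies in one of its members, which is then all of
  \<open>exp(A, a)\<close> and cannot grow.\<close>

lemma process_terminates:
  fixes G :: "nat \<Rightarrow> ('k :: field, 'n) mps list"
  assumes 0: "0 \<notin> set (G 0)" and step: "\<And>k. process_step prec a (G k) (G (Suc k))"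
    and E: "finite E" "exp_set prec a (power_subalg (set (G 0))) = semigroup_gen E"
  shows False
proof -
  have G: "0 \<notin> set (G k) \<and> power_subalg (set (G k)) = power_subalg (set (G 0))" for k
    by (induction k) (use 0 process_step_extension(1,2)[OF _ step] in auto)
  note ext = process_step_extension[OF conjunct1[OF G] step]
  have mono: "semigroup_gen (lx ` set (G j)) \<subseteq> semigroup_gen (lx ` set (G k))" if "j \<le> k" for j k
    using that by (rule lift_Suc_mono_le[rotated]) (use ext(4) in blast)
  have "\<forall>e \<in> E. \<exists>j. e \<in> semigroup_gen (lx ` set (G j))"
    using exp_set_covered[of G] G ext(3) E(2) semigroup_gen.gen by metis
  from bchoice[OF this] obtain j where j: "\<forall>e \<in> E. e \<in> semigroup_gen (lx ` set (G (j e)))"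
    by blast
  define K where "K = Max (insert 0 (j ` E))"
  have "j e \<le> K" if "e \<in> E" for e
    unfolding K_def using E(1) that by (intro Max_ge) auto
  then have "E \<subseteq> semigroup_gen (lx ` set (G K))"
    using j mono by blast
  then have "semigroup_gen E \<subseteq> semigroup_gen (lx ` set (G K))"
    by (rule semigroup_gen_least)
  moreover have "semigroup_gen (lx ` set (G (Suc K))) \<subseteq> semigroup_gen E"
    using ext(5)[of K] G[of K] E(2) by simp
  ultimately show False
    using ext(4)[of K] by blast
qed

end

theorem mainTheorem3:
  fixes prec :: "nat ^ 'n \<Rightarrow> nat ^ 'n \<Rightarrow> bool"
    and a :: "real ^ 'n"
    and fs Rs :: "('k :: field, 'n :: finite) mps list"
    and Ss :: "'k mpoly list"
    and A :: "('k, 'n) mps set"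
  assumes "monomial_order prec"
    and "\<forall>i. a $ i \<in> \<rat> \<and> a $ i > 0"
    and "0 \<notin> set fs"
    and "A = power_subalg (set fs)"
    and "\<exists>E. finite E \<and> exp_set prec a A = semigroup_gen E"
    and "ker_generators prec a fs Ss"
    and "remainders prec a fs Ss Rs"
  shows "((\<forall>S \<in> set Ss. homogeneous prec a fs S) \<longrightarrow> (\<forall>R \<in> set Rs. R = 0) \<longrightarrow>
            canonical_basis prec a A (set fs)) \<and>
    (\<forall>gs. (\<exists>R \<in> set Rs. R \<noteq> 0) \<and> extended_by fs Rs gs \<longrightarrow>
            power_subalg (set gs) = A \<and>
            semigroup_gen (lexp prec a ` set fs) \<subset> semigroup_gen (lexp prec a ` set gs) \<and>
            semigroup_gen (lexp prec a ` set gs) \<subseteq> exp_set prec a A) \<and>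
    (\<nexists>G. G 0 = fs \<and> (\<forall>k :: nat. process_step prec a (G k) (G (Suc k)))) \<and>
    (\<forall>gs. (process_step prec a)\<^sup>*\<^sup>* fs gs \<longrightarrow>
            (process_stops prec a gs \<or> (\<exists>hs. process_step prec a gs hs)) \<and>
            (process_stops prec a gs \<longrightarrow> canonical_basis prec a A (set gs)))"
proof -
  interpret weighted_order prec a
    using assms(1,2) by unfold_locales auto
  have reach: "0 \<notin> set gs \<and> power_subalg (set gs) = A" if "(process_step prec a)\<^sup>*\<^sup>* fs gs" for gs
    using that
  proof induction
    case base
    show ?case
      using assms(3,4) by simp
  next
    case (step gs hs)
    then show ?case
      using process_step_extension(1,2) by blast
  qed
  show ?thesis
  proof (intro conjI allI impI)
    assume "\<forall>S \<in> set Ss. homogeneous prec a fs S" "\<forall>R \<in> set Rs. R = 0"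
    then show "canonical_basis prec a A (set fs)"
      unfolding assms(4) using assms(3,6,7)
      by (intro canonical_basisI) (auto simp: admissible_choice_def)
  next
    fix gs assume gs: "(\<exists>R \<in> set Rs. R \<noteq> 0) \<and> extended_by fs Rs gs"
    note ext = extended_by_enlarges_semigroup[OF assms(3,7) conjunct1[OF gs] conjunct2[OF gs], folded assms(4)]
    show "power_subalg (set gs) = A"
      "semigroup_gen (lexp prec a ` set fs) \<subset> semigroup_gen (lexp prec a ` set gs)"
      "semigroup_gen (lexp prec a ` set gs) \<subseteq> exp_set prec a A"
      by (rule ext)+
  next
    obtain E where "finite E" "exp_set prec a A = semigroup_gen E"
      using assms(5) by blast
    then show "\<nexists>G. G 0 = fs \<and> (\<forall>k. process_step prec a (G k) (G (Suc k)))"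
      using process_terminates assms(3,4) by blast
  next
    fix gs assume "(process_step prec a)\<^sup>*\<^sup>* fs gs"
    note gs = reach[OF this]
    show "process_stops prec a gs \<or> (\<exists>hs. process_step prec a gs hs)"
      using gs by (intro process_continues) simp
    show "canonical_basis prec a A (set gs)" if "process_stops prec a gs"
      using that gs canonical_basisI[of gs] unfolding process_stops_def by auto
  qed
qed

end
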